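(* Let $E,F$ be complex Banach spaces, $U\subseteq E$ open, $v$ a weight on $U$, $p\in[1,\infty)$, and $f\in\mathcal H_v^\infty(U,F)$. The following are equivalent: (i) $f\in\mathcal H^\infty_{v\mathcal N^p}(U,F)$; (ii) $T_f\in\mathcal N^p(\mathcal G_v^\infty(U),F)$. In this case, $\|f\|_{\mathcal H^\infty_{v\mathcal N^p}}=\|T_f\|_{\mathcal N^p}$. Furthermore, the mapping $f\mapsto T_f$ is an isometric isomorphism from $(\mathcal H^\infty_{v\mathcal N^p}(U,F),\|\cdot\|_{\mathcal H^\infty_{v\mathcal N^p}})$ onto $(\mathcal N^p(\mathcal G_v^\infty(U),F),\|\cdot\|_{\mathcal N^p})$.
   Context: A weight on $U$ is a strictly positive continuous function. $\mathcal H_v^\infty(U,F)$ is the Banach space of holomorphic $f\colon U\to F$ with $\|f\|_v:=\sup_{x\in U}v(x)\|f(x)\|<\infty$; $\mathcal H_v^\infty(U):=\mathcal H_v^\infty(U,\mathbb C)$. $\mathcal L(X,Y)$ denotes the bounded linear operators with the operator norm. Linearization: $\mathcal G_v^\infty(U)$ is the closed subspace of $\mathcal H_v^\infty(U)^*$ consisting of all linear functionals on $\mathcal H_v^\infty(U)$ whose restriction to the closed unit ball of $\mathcal H_v^\infty(U)$ is continuous for the compact-open topology. $\Delta_v\colon U\to\mathcal G_v^\infty(U)$ is $\Delta_v(x)=\delta_x$, where $\delta_x(g)=g(x)$. For $f\in\mathcal H_v^\infty(U,F)$, $T_f$ is the unique operator in $\mathcal L(\mathcal G_v^\infty(U),F)$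 with $T_f\circ\Delta_v=f$. For a Banach space $X$, $\ell_p(X)$ is the space of sequences with $\|(x_n)\|_p=(\sum\|x_n\|^p)^{1/p}<\infty$, and $\ell_q^w(X)$ of those with $\|(x_n)\|_q^w=\sup_{x^*\in B_{X^*}}\|(x^*(x_n))\|_q<\infty$ (for $q=\infty$ this is the space of bounded sequences with the supremum norm). $p^*$ is the conjugate index of $p$. An operator $T\in\mathcal L(X,Y)$ is right $p$-nuclear, $T\in\mathcal N^p(X,Y)$, if there are $(x_n^* )\in\ell_{p^*}^w(X^* )$ and $(y_n)\in\ell_p(Y)$ with $T(x)=\sum_{n=1}^\infty x_n^*(x)y_n$ for all $x\in X$, the series converging in $\mathcal L(X,Y)$; $\|T\|_{\mathcal N^p}=\inf\|(x_n^* )\|_{p^*}^w\|(y_n)\|_p$ over all such representations. A mapping $f\in\mathcal H_v^\infty(U,F)$ is right $p$-nuclear, $f\in\mathcal H^\infty_{v\mathcal N^p}(U,F)$, if there are $(g_n)\in\ell_{p^*}^w(\mathcal H_v^\infty(U))$ and $(y_n)\in\ell_p(F)$ with $f=\sum_{n=1}^\infty g_n\cdot y_n$ in $(\mathcal H_v^\infty(U,F),\|\cdot\|_v)$, where $(g\cdot y)(x)=g(x)y$; $\|f\|_{\mathcal H^\infty_{v\mathcal N^p}}=\inf\|(g_n)\|_{p^*}^w\|(y_n)\|_p$ over all such representations. *)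

theory Defs
  imports "HOL-Analysis.Analysis" "HOL-Library.Function_Algebras"
begin

section \<open>Complex Banach spaces\<close>

class scaleC =
  fixes scaleC :: "complex \<Rightarrow> 'a \<Rightarrow> 'a"  (infixr "*\<^sub>C" 75)

class complex_vector = scaleC + ab_group_add +
  assumes scaleC_add_right: "a *\<^sub>C (x + y) = a *\<^sub>C x + a *\<^sub>C y"
    and scaleC_add_left: "(a + b) *\<^sub>C x = a *\<^sub>C x + b *\<^sub>C x"
    and scaleC_scaleC: "a *\<^sub>C b *\<^sub>C x = (a * b) *\<^sub>C x"
    and scaleC_one: "1 *\<^sub>C x = x"

class complex_normed_vector = complex_vector + real_normed_vector +
  assumes scaleR_scaleC: "r *\<^sub>R x = complex_of_real r *\<^sub>C x"
    and norm_scaleC: "norm (a *\<^sub>C x) = cmod a * norm x"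

class cbanach = complex_normed_vector + complete_space

instantiation complex :: cbanach
begin

definition scaleC_complex :: "complex \<Rightarrow> complex \<Rightarrow> complex"
  where "scaleC_complex a x = a * x"

instance
  by standard
    (simp_all add: scaleC_complex_def algebra_simps norm_mult scaleR_conv_of_real)

end

instantiation "fun" :: (type, complex_vector) complex_vector
begin

definition scaleC_fun :: "complex \<Rightarrow> ('a \<Rightarrow> 'b) \<Rightarrow> 'a \<Rightarrow> 'b"
  where "scaleC_fun a f = (\<lambda>x. a *\<^sub>C f x)"

instance
  by standard
    (simp_all add: scaleC_fun_def fun_eq_iff scaleC_add_right scaleC_add_left
      scaleC_scaleC scaleC_one)

end

section \<open>Normed spaces given by a carrier and a norm\<close>

text \<open>
  The spaces below depend on \<open>U\<close>, \<open>v\<close> and \<open>p\<close>, so they cannot be types. Such a space is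
  given by a linear subspace of an ambient complex vector space (usually a function space with
  the pointwise operations) and a norm, which is only meaningful on that subspace. Functions on
  a set and operators on a carrier are represented by total functions that vanish off their
  domain, so that each of them is represented exactly once.
\<close>

record 'a nvs =
  carrier :: "'a set"
  nrm :: "'a \<Rightarrow> real"

definition whole_space :: "'a::complex_normed_vector nvs" where
  "whole_space = \<lparr>carrier = UNIV, nrm = norm\<rparr>"

definition unit_ball :: "'a nvs \<Rightarrow> 'a set" where
  "unit_ball X = {x \<in> carrier X. nrm X x \<le> 1}"

definition linear_between ::
    "'a::complex_vector nvs \<Rightarrow> 'b::complex_vector nvs \<Rightarrow> ('a \<Rightarrow> 'b) \<Rightarrow> bool" where
  "linear_between X Y T \<longleftrightarrow>
     (\<forall>x\<in>carrier X. T x \<in> carrier Y) \<and>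
     (\<forall>x\<in>carrier X. \<forall>y\<in>carrier X. T (x + y) = T x + T y) \<and>
     (\<forall>c. \<forall>x\<in>carrier X. T (c *\<^sub>C x) = c *\<^sub>C T x)"

definition bounded_ops ::
    "'a::complex_vector nvs \<Rightarrow> 'b::complex_vector nvs \<Rightarrow> ('a \<Rightarrow> 'b) nvs" where
  "bounded_ops X Y =
     \<lparr>carrier = {T. linear_between X Y T \<and>
                    (\<exists>B. \<forall>x\<in>carrier X. nrm Y (T x) \<le> B * nrm X x) \<and>
                    (\<forall>x. x \<notin> carrier X \<longrightarrow> T x = 0)},
      nrm = (\<lambda>T. SUP x\<in>unit_ball X. nrm Y (T x))\<rparr>"

definition dual :: "'a::complex_vector nvs \<Rightarrow> ('a \<Rightarrow> complex) nvs" where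
  "dual X = bounded_ops X whole_space"

definition isometric_isomorphism ::
    "'a::complex_vector nvs \<Rightarrow> 'b::complex_vector nvs \<Rightarrow> ('a \<Rightarrow> 'b) \<Rightarrow> bool" where
  "isometric_isomorphism X Y J \<longleftrightarrow>
     linear_between X Y J \<and> bij_betw J (carrier X) (carrier Y) \<and>
     (\<forall>x\<in>carrier X. nrm Y (J x) = nrm X x)"

section \<open>Sequence spaces\<close>

definition conj_index :: "real \<Rightarrow> ereal" where
  "conj_index p = (if p = 1 then \<infinity> else ereal (p / (p - 1)))"

text \<open>The exponent \<open>q\<close> ranges over \<open>[1, \<infinity>]\<close>.\<close>

definition ell :: "ereal \<Rightarrow> 'a nvs \<Rightarrow> (nat \<Rightarrow> 'a) nvs" where
  "ell q X =
     \<lparr>carrier = {x. range x \<subseteq> carrier X \<and>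
                    (if q = \<infinity> then bdd_above (range (\<lambda>n. nrm X (x n)))
                     else summable (\<lambda>n. nrm X (x n) powr real_of_ereal q))},
      nrm = (\<lambda>x. if q = \<infinity> then (SUP n. nrm X (x n))
                  else (\<Sum>n. nrm X (x n) powr real_of_ereal q) powr (1 / real_of_ereal q))\<rparr>"

definition ell_weak :: "ereal \<Rightarrow> 'a::complex_vector nvs \<Rightarrow> (nat \<Rightarrow> 'a) nvs" where
  "ell_weak q X =
     \<lparr>carrier = {x. range x \<subseteq> carrier X \<and>
        (\<forall>\<phi>\<in>unit_ball (dual X). (\<lambda>n. \<phi> (x n)) \<in> carrier (ell q whole_space)) \<and>
        bdd_above ((\<lambda>\<phi>. nrm (ell q whole_space) (\<lambda>n. \<phi> (x n))) ` unit_ball (dual X))},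
      nrm = (\<lambda>x. SUP \<phi>\<in>unit_ball (dual X). nrm (ell q whole_space) (\<lambda>n. \<phi> (x n)))\<rparr>"

section \<open>Right \<open>p\<close>-nuclear operators\<close>

text \<open>
  In both this section and the one on mappings, \<open>(\<lambda>x. a x *\<^sub>C y)\<close> is the elementary tensor of
  a scalar function \<open>a\<close> and a vector \<open>y\<close>; sums and differences of functions are pointwise.
\<close>

definition nuclear_op_rep ::
    "real \<Rightarrow> 'a::complex_vector nvs \<Rightarrow> 'b::complex_vector nvs \<Rightarrow> ('a \<Rightarrow> 'b) \<Rightarrow>
     (nat \<Rightarrow> 'a \<Rightarrow> complex) \<Rightarrow> (nat \<Rightarrow> 'b) \<Rightarrow> bool" where
  "nuclear_op_rep p X Y T \<phi> y \<longleftrightarrow>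
     \<phi> \<in> carrier (ell_weak (conj_index p) (dual X)) \<and>
     y \<in> carrier (ell (ereal p) Y) \<and>
     (\<lambda>N. nrm (bounded_ops X Y) (T - (\<Sum>n<N. (\<lambda>x. \<phi> n x *\<^sub>C y n)))) \<longlonglongrightarrow> 0"

definition nuclear_ops ::
    "real \<Rightarrow> 'a::complex_vector nvs \<Rightarrow> 'b::complex_vector nvs \<Rightarrow> ('a \<Rightarrow> 'b) nvs" where
  "nuclear_ops p X Y =
     \<lparr>carrier = {T \<in> carrier (bounded_ops X Y). \<exists>\<phi> y. nuclear_op_rep p X Y T \<phi> y},
      nrm = (\<lambda>T. Inf {nrm (ell_weak (conj_index p) (dual X)) \<phi> * nrm (ell (ereal p) Y) y
                       | \<phi> y. nuclear_op_rep p X Y T \<phi> y})\<rparr>"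

section \<open>Weighted spaces of holomorphic mappings\<close>

definition weight_on :: "'e::topological_space set \<Rightarrow> ('e \<Rightarrow> real) \<Rightarrow> bool" where
  "weight_on U v \<longleftrightarrow> continuous_on U v \<and> (\<forall>x\<in>U. 0 < v x)"

text \<open>
  Holomorphy is complex Frechet differentiability: \<open>has_derivative\<close> already makes \<open>D\<close> bounded
  and real-linear.
\<close>

definition holomorphic_map_on ::
    "('e::complex_normed_vector \<Rightarrow> 'f::complex_normed_vector) \<Rightarrow> 'e set \<Rightarrow> bool" where
  "holomorphic_map_on f U \<longleftrightarrow>
     (\<forall>x\<in>U. \<exists>D. (f has_derivative D) (at x) \<and> (\<forall>c h. D (c *\<^sub>C h) = c *\<^sub>C D h))"

text \<open>Inserting \<open>0\<close> only matters when \<open>U\<close> is empty.\<close>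

definition Hv :: "'e set \<Rightarrow> ('e \<Rightarrow> real) \<Rightarrow>
    ('e::complex_normed_vector \<Rightarrow> 'f::complex_normed_vector) nvs" where
  "Hv U v =
     \<lparr>carrier = {f. holomorphic_map_on f U \<and> bdd_above ((\<lambda>x. v x * norm (f x)) ` U) \<and>
                    (\<forall>x. x \<notin> U \<longrightarrow> f x = 0)},
      nrm = (\<lambda>f. Sup (insert 0 ((\<lambda>x. v x * norm (f x)) ` U)))\<rparr>"

definition compact_open :: "'e::topological_space set \<Rightarrow> ('e \<Rightarrow> 'f::topological_space) topology"
  where "compact_open U =
    topology_generated_by {{f. f ` K \<subseteq> V} | K V. compact K \<and> K \<subseteq> U \<and> open V}"

definition Gv :: "'e::complex_normed_vector set \<Rightarrow> ('e \<Rightarrow> real) \<Rightarrow> (('e \<Rightarrow> complex) \<Rightarrow> complex) nvs"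
  where "Gv U v =
    \<lparr>carrier = {\<phi> \<in> carrier (dual (Hv U v)).
                  continuous_map (subtopology (compact_open U) (unit_ball (Hv U v))) euclidean \<phi>},
     nrm = nrm (dual (Hv U v))\<rparr>"

definition Delta :: "'e::complex_normed_vector set \<Rightarrow> ('e \<Rightarrow> real) \<Rightarrow> 'e \<Rightarrow> ('e \<Rightarrow> complex) \<Rightarrow> complex"
  where "Delta U v x = (\<lambda>g. if g \<in> carrier (Hv U v) then g x else 0)"

definition linearization :: "'e::complex_normed_vector set \<Rightarrow> ('e \<Rightarrow> real) \<Rightarrow>
    ('e \<Rightarrow> 'f::complex_normed_vector) \<Rightarrow> (('e \<Rightarrow> complex) \<Rightarrow> complex) \<Rightarrow> 'f" where
  "linearization U v f =
     (THE T. T \<in> carrier (bounded_ops (Gv U v) whole_space) \<and> (\<forall>x\<in>U. T (Delta U v x) = f x))"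

section \<open>Right \<open>p\<close>-nuclear weighted holomorphic mappings\<close>

definition nuclear_map_rep :: "real \<Rightarrow> 'e set \<Rightarrow> ('e \<Rightarrow> real) \<Rightarrow>
    ('e::complex_normed_vector \<Rightarrow> 'f::complex_normed_vector) \<Rightarrow>
    (nat \<Rightarrow> 'e \<Rightarrow> complex) \<Rightarrow> (nat \<Rightarrow> 'f) \<Rightarrow> bool" where
  "nuclear_map_rep p U v f g y \<longleftrightarrow>
     g \<in> carrier (ell_weak (conj_index p) (Hv U v)) \<and>
     y \<in> carrier (ell (ereal p) whole_space) \<and>
     (\<lambda>N. nrm (Hv U v) (f - (\<Sum>n<N. (\<lambda>x. g n x *\<^sub>C y n)))) \<longlonglongrightarrow> 0"

definition nuclear_maps :: "real \<Rightarrow> 'e set \<Rightarrow> ('e \<Rightarrow> real) \<Rightarrow>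
    ('e::complex_normed_vector \<Rightarrow> 'f::complex_normed_vector) nvs" where
  "nuclear_maps p U v =
     \<lparr>carrier = {f \<in> carrier (Hv U v). \<exists>g y. nuclear_map_rep p U v f g y},
      nrm = (\<lambda>f. Inf {nrm (ell_weak (conj_index p) (Hv U v)) g * nrm (ell (ereal p) whole_space) y
                       | g y. nuclear_map_rep p U v f g y})\<rparr>"

end

(* A functional phi in G is dominated on H by eps * ||.|| plus a finite sum of seminorms C * |g(x)|:
   by Cauchy's estimates the unit ball of H is equicontinuous, so there the compact-open topology
   is that of pointwise convergence. Splitting phi along these seminorms with the Hahn-Banach
   theorem shows that the evaluations span a dense subspace of G. Hence T_f(phi) can be defined
   weakly, as the vector y with L(y) = phi(L o f) for all functionals L on F. Conversely Delta is
   holomorphic, again by Cauchy's estimates, so f |-> T_f is an isometric isomorphism of the space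
   of all weighted holomorphic mappings onto L(G, F). It maps g . y to T_g . y, and its scalar case
   H = G^* preserves weak l_q norms, so it matches the nuclear representations of f and of T_f. *)
theory Submission
  imports Defs "HOL-Complex_Analysis.Cauchy_Integral_Formula"
begin

section \<open>Sublinear functionals on complex subspaces\<close>

text \<open>A functional in G is continuous only on the unit ball of H, so no finite set of points
  controls it on all of H: rescaling an arbitrary g into the ball leaves the extra term eps * ||g||.
  This is why the evaluations come out dense and not spanning, and why the Hahn-Banach step must
  separate a norm part from finitely many point parts. The Mazur-Orlicz form of the theorem does
  this inside H itself. Defining T_f by linearity on the span of the evaluations would raise the
  question whether a value depends on the chosen combination. The weak description settles it,
  because a norming functional bounds any weak value y by ||f|| * ||phi||. That single estimate
  yields uniqueness, boundedness and the Cauchy property of values along an approximation;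
  completeness of F then supplies the limit. For the converse, the derivative of Delta must have its
  values in G again. They are norm limits of difference quotients of evaluations, G is closed under
  such limits, and the quadratic remainder in Cauchy's estimates is uniform over the unit ball,
  which gives differentiability in norm.\<close>

lemma scaleC_zero_right [simp]: "a *\<^sub>C (0::'a::complex_vector) = 0"
  using scaleC_add_right[of a 0 "0::'a"] by simp

lemma scaleC_zero_left [simp]: "0 *\<^sub>C (x::'a::complex_vector) = 0"
  using scaleC_add_left[of 0 0 x] by simp

lemma scaleC_one_left [simp]: "1 *\<^sub>C (x::'a::complex_vector) = x"
  by (fact scaleC_one)

lemma scaleC_minus_left: "(- a) *\<^sub>C (x::'a::complex_vector) = - (a *\<^sub>C x)"
proof -
  have "(- a) *\<^sub>C x + a *\<^sub>C x = 0"
    using scaleC_add_left[of "- a" a x] by simp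
  then show ?thesis by (simp add: eq_neg_iff_add_eq_0)
qed

lemma scaleC_fun_apply [simp]: "(c *\<^sub>C f) x = c *\<^sub>C f x"
  by (simp add: scaleC_fun_def)

locale complex_subspace =
  fixes S :: "'a::complex_vector set"
  assumes zero_mem: "0 \<in> S"
    and add_mem: "x \<in> S \<Longrightarrow> y \<in> S \<Longrightarrow> x + y \<in> S"
    and scaleC_mem: "x \<in> S \<Longrightarrow> c *\<^sub>C x \<in> S"
begin

lemma minus_mem: "x \<in> S \<Longrightarrow> - x \<in> S"
  using scaleC_mem[of x "-1"] by (simp add: scaleC_minus_left)

lemma diff_mem: "x \<in> S \<Longrightarrow> y \<in> S \<Longrightarrow> x - y \<in> S"
  using add_mem[of x "- y"] minus_mem by simp

lemma sum_mem: "(\<And>i. i \<in> I \<Longrightarrow> f i \<in> S) \<Longrightarrow> sum f I \<in> S"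
  by (induction I rule: infinite_finite_induct) (auto intro: zero_mem add_mem)

end

text \<open>Real scalars enter through \<open>complex_of_real\<close>, since
  \<open>complex_vector\<close> carries no real scaling of its own.\<close>

definition sublinear_on :: "'a::complex_vector set \<Rightarrow> ('a \<Rightarrow> real) \<Rightarrow> bool" where
  "sublinear_on S q \<longleftrightarrow>
     (\<forall>x\<in>S. \<forall>y\<in>S. q (x + y) \<le> q x + q y) \<and>
     (\<forall>t\<ge>0. \<forall>x\<in>S. q (complex_of_real t *\<^sub>C x) = t * q x)"

definition real_linear_on :: "'a::complex_vector set \<Rightarrow> ('a \<Rightarrow> real) \<Rightarrow> bool" where
  "real_linear_on S l \<longleftrightarrow>
     (\<forall>x\<in>S. \<forall>y\<in>S. l (x + y) = l x + l y) \<and>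
     (\<forall>t. \<forall>x\<in>S. l (complex_of_real t *\<^sub>C x) = t * l x)"

definition seminorm_on :: "'a::complex_vector set \<Rightarrow> ('a \<Rightarrow> real) \<Rightarrow> bool" where
  "seminorm_on S p \<longleftrightarrow>
     (\<forall>x\<in>S. \<forall>y\<in>S. p (x + y) \<le> p x + p y) \<and>
     (\<forall>c. \<forall>x\<in>S. p (c *\<^sub>C x) = cmod c * p x)"

lemma seminorm_on_imp_sublinear_on: "seminorm_on S p \<Longrightarrow> sublinear_on S p"
  unfolding seminorm_on_def sublinear_on_def by auto

lemma seminorm_on_add:
  assumes "seminorm_on S p" "seminorm_on S q"
  shows "seminorm_on S (\<lambda>x. p x + q x)"
  unfolding seminorm_on_def
proof (intro conjI ballI allI)
  fix x y assume "x \<in> S" "y \<in> S"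
  then have "p (x + y) \<le> p x + p y" "q (x + y) \<le> q x + q y"
    using assms unfolding seminorm_on_def by auto
  then show "p (x + y) + q (x + y) \<le> p x + q x + (p y + q y)" by simp
next
  fix c x assume "x \<in> S"
  then show "p (c *\<^sub>C x) + q (c *\<^sub>C x) = cmod c * (p x + q x)"
    using assms unfolding seminorm_on_def by (simp add: distrib_left)
qed

lemma seminorm_on_sum:
  assumes "\<And>i. i \<in> I \<Longrightarrow> seminorm_on S (p i)"
  shows "seminorm_on S (\<lambda>x. \<Sum>i\<in>I. p i x)"
  using assms
proof (induction I rule: infinite_finite_induct)
  case (insert i I)
  then show ?case using seminorm_on_add[of S "p i" "\<lambda>x. \<Sum>i\<in>I. p i x"] by simp
qed (simp_all add: seminorm_on_def)

context complex_subspace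
begin

text \<open>Applying the one-sided bound with \<open>inverse t\<close> to the scaled vector reverses
  it, and the factors 2 and 1/2 at the origin force \<open>q 0 = 0\<close>.\<close>

lemma sublinear_onI:
  assumes sub: "\<And>x y. x \<in> S \<Longrightarrow> y \<in> S \<Longrightarrow> q (x + y) \<le> q x + q y"
    and pos: "\<And>t x. t > 0 \<Longrightarrow> x \<in> S \<Longrightarrow> q (complex_of_real t *\<^sub>C x) \<le> t * q x"
  shows "sublinear_on S q"
proof -
  have "q 0 \<le> 2 * q 0" "q 0 \<le> (1/2) * q 0"
    using pos[of 2 0] pos[of "1/2" 0] zero_mem by simp_all
  then have q0: "q 0 = 0" by simp
  have "q (complex_of_real t *\<^sub>C x) = t * q x" if "t \<ge> 0" "x \<in> S" for t x
  proof (cases "t = 0")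
    case True
    then show ?thesis using q0 by simp
  next
    case False
    then have t: "t > 0" using that by simp
    have "q x = q (complex_of_real (inverse t) *\<^sub>C (complex_of_real t *\<^sub>C x))"
      using t by (simp add: scaleC_scaleC flip: of_real_mult)
    also have "\<dots> \<le> inverse t * q (complex_of_real t *\<^sub>C x)"
      using t that by (intro pos scaleC_mem) auto
    finally have "t * q x \<le> q (complex_of_real t *\<^sub>C x)"
      using t by (simp add: field_simps)
    with pos[OF t that(2)] show ?thesis by simp
  qed
  with sub show ?thesis unfolding sublinear_on_def by auto
qed

lemma sublinear_on_zero:
  assumes "sublinear_on S q" shows "q 0 = 0"
proof -
  have "q (complex_of_real 0 *\<^sub>C 0) = 0 * q 0"
    using assms zero_mem unfolding sublinear_on_def by blast
  then show ?thesis by simp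
qed

lemma sublinear_on_minus:
  assumes "sublinear_on S q" "x \<in> S" shows "- q (- x) \<le> q x"
proof -
  have "q (x + (- x)) \<le> q x + q (- x)"
    using assms minus_mem unfolding sublinear_on_def by blast
  then show ?thesis using sublinear_on_zero[OF assms(1)] by simp
qed

text \<open>This is the infimal convolution of \<open>q\<close> with the convex cone
  \<open>P\<close>. It lies below \<open>q\<close>, by the vertex of the cone, and takes a value of
  at most \<open>b\<close> at \<open>- w\<close>. The hypothesis \<open>bound\<close> together with
  subadditivity gives the lower bound \<open>- q (- x)\<close>, so that the infimum is a genuine
  one.\<close>

lemma sublinear_on_inf_cone:
  fixes P :: "('a \<times> real) set"
  assumes q: "sublinear_on S q"
    and zero: "(0, 0) \<in> P"
    and add: "\<And>w b w' b'. (w, b) \<in> P \<Longrightarrow> (w', b') \<in> P \<Longrightarrow> (w + w', b + b') \<in> P"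
    and scale: "\<And>w b t. (w, b) \<in> P \<Longrightarrow> t > 0 \<Longrightarrow> (complex_of_real t *\<^sub>C w, t * b) \<in> P"
    and mem: "\<And>w b. (w, b) \<in> P \<Longrightarrow> w \<in> S"
    and bound: "\<And>w b. (w, b) \<in> P \<Longrightarrow> - q w \<le> b"
  defines "r \<equiv> \<lambda>x. INF (w, b)\<in>P. q (x + w) + b"
  shows "sublinear_on S r"
    and "\<And>x w b. x \<in> S \<Longrightarrow> (w, b) \<in> P \<Longrightarrow> r x \<le> q (x + w) + b"
proof -
  have lower: "- q (- x) \<le> q (x + w) + b" if "x \<in> S" "(w, b) \<in> P" for x w b
  proof -
    have "q ((x + w) + (- x)) \<le> q (x + w) + q (- x)"
      using q that mem add_mem minus_mem unfolding sublinear_on_def by blast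
    then show ?thesis using bound[OF that(2)] by simp
  qed
  have r_le: "r x \<le> q (x + w) + b" if "x \<in> S" "(w, b) \<in> P" for x w b
    unfolding r_def
    by (rule cINF_lower2[where x = "(w, b)"])
      (use that lower in \<open>auto intro!: bdd_belowI2[where m = "- q (- x)"]\<close>)
  then show "\<And>x w b. x \<in> S \<Longrightarrow> (w, b) \<in> P \<Longrightarrow> r x \<le> q (x + w) + b" .
  have r_ge: "m \<le> r x" if "\<And>w b. (w, b) \<in> P \<Longrightarrow> m \<le> q (x + w) + b" for m x
    unfolding r_def by (rule cINF_greatest) (use zero that in auto)
  show "sublinear_on S r"
  proof (rule sublinear_onI)
    fix x y assume xy: "x \<in> S" "y \<in> S"
    \<comment> \<open>The two infima are taken one after the other: over \<open>(w, b)\<close> with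
      \<open>(w', b')\<close> fixed, then over \<open>(w', b')\<close>.\<close>
    have "r (x + y) - (q (y + w') + b') \<le> r x" if P': "(w', b') \<in> P" for w' b'
    proof (rule r_ge)
      fix w b assume P: "(w, b) \<in> P"
      have "r (x + y) \<le> q ((x + y) + (w + w')) + (b + b')"
        using xy P P' by (intro r_le add add_mem)
      also have "q ((x + y) + (w + w')) = q ((x + w) + (y + w'))"
        by (simp add: algebra_simps)
      also have "\<dots> \<le> q (x + w) + q (y + w')"
        using q xy mem[OF P] mem[OF P'] add_mem unfolding sublinear_on_def by blast
      finally show "r (x + y) - (q (y + w') + b') \<le> q (x + w) + b" by simp
    qed
    then have "r (x + y) - r x \<le> r y" by (intro r_ge) force
    then show "r (x + y) \<le> r x + r y" by simp
  next
    fix t :: real and x assume t: "t > 0" and x: "x \<in> S"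
    have "r (complex_of_real t *\<^sub>C x) / t \<le> r x"
    proof (rule r_ge)
      fix w b assume P: "(w, b) \<in> P"
      have "r (complex_of_real t *\<^sub>C x)
          \<le> q (complex_of_real t *\<^sub>C x + complex_of_real t *\<^sub>C w) + t * b"
        using x P t by (intro r_le scale scaleC_mem)
      also have "\<dots> = t * (q (x + w) + b)"
        using q t add_mem[OF x mem[OF P]] unfolding sublinear_on_def
        by (simp add: algebra_simps flip: scaleC_add_right)
      finally show "r (complex_of_real t *\<^sub>C x) / t \<le> q (x + w) + b"
        using t by (simp add: field_simps)
    qed
    then show "r (complex_of_real t *\<^sub>C x) \<le> t * r x"
      using t by (simp add: field_simps)
  qed
qed

text \<open>Zorn's lemma for the reversed pointwise order. The pointwise infimum of a chain is again
  sublinear, and it is finite because every sublinear minorant of \<open>q\<close> stays above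
  \<open>- q (- x)\<close>.\<close>

lemma minimal_sublinear_exists:
  assumes q: "sublinear_on S q"
  obtains m where "sublinear_on S m" "\<And>x. x \<in> S \<Longrightarrow> m x \<le> q x"
    "\<And>r x. sublinear_on S r \<Longrightarrow> (\<And>x. x \<in> S \<Longrightarrow> r x \<le> m x) \<Longrightarrow> x \<in> S \<Longrightarrow> r x = m x"
proof -
  define A where "A = {r. sublinear_on S r \<and> (\<forall>x\<in>S. r x \<le> q x) \<and> (\<forall>x. x \<notin> S \<longrightarrow> r x = 0)}"
  \<comment> \<open>Setting functions to 0 off \<open>S\<close> makes agreement on \<open>S\<close>
    the same as equality, as the order on whole functions in Zorn's lemma requires.\<close>
  define cut where "cut r = (\<lambda>x. if x \<in> S then r x else 0)" for r :: "'a \<Rightarrow> real"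
  have cut_sub: "sublinear_on S (cut r)" if "sublinear_on S r" for r
    using that add_mem scaleC_mem unfolding sublinear_on_def cut_def by simp
  have "\<exists>m\<in>A. \<forall>a\<in>A. a \<le> m \<longrightarrow> a = m"
  proof (rule predicate_Zorn)
    show "partial_order_on A (relation_of (\<lambda>a b. b \<le> a) A)"
      by (rule partial_order_on_relation_ofI) auto
  next
    fix C assume "C \<in> Chains (relation_of (\<lambda>a b. b \<le> a) A)"
    then have CA: "C \<subseteq> A" and chain: "\<And>a b. a \<in> C \<Longrightarrow> b \<in> C \<Longrightarrow> a \<le> b \<or> b \<le> a"
      unfolding Chains_def relation_of_def by auto
    show "\<exists>u\<in>A. \<forall>a\<in>C. u \<le> a"
    proof (cases "C = {}")
      case True
      then show ?thesis using cut_sub[OF q] unfolding A_def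
        by (intro bexI[of _ "cut q"]) (auto simp: cut_def)
    next
      case False
      define u where "u = (\<lambda>x. if x \<in> S then INF r\<in>C. r x else 0)"
      have low: "- q (- x) \<le> r x" if "x \<in> S" "r \<in> C" for x r
      proof -
        have "- r (- x) \<le> r x" "r (- x) \<le> q (- x)"
          using that CA sublinear_on_minus minus_mem unfolding A_def by auto
        then show ?thesis by simp
      qed
      have u_le: "u x \<le> r x" if "x \<in> S" "r \<in> C" for x r
        unfolding u_def using that low
        by (auto intro!: cINF_lower bdd_belowI2[where m = "- q (- x)"])
      have u_ge: "b \<le> u x" if "\<And>r. r \<in> C \<Longrightarrow> b \<le> r x" "x \<in> S" for b x
        unfolding u_def using that False by (auto intro!: cINF_greatest)
      have "sublinear_on S u"
      proof (rule sublinear_onI)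
        fix x y assume xy: "x \<in> S" "y \<in> S"
        have *: "u (x + y) \<le> r x + r' y" if r: "r \<in> C" "r' \<in> C" for r r'
        proof -
          \<comment> \<open>Two different members of the chain have to be mixed in one inequality;
            the smaller of the two lies below both.\<close>
          obtain s where s: "s \<in> C" "s \<le> r" "s \<le> r'" using chain[OF r] r by blast
          have "u (x + y) \<le> s (x + y)" using u_le s xy add_mem by blast
          also have "\<dots> \<le> s x + s y"
            using s CA xy unfolding A_def sublinear_on_def by blast
          also have "\<dots> \<le> r x + r' y" using s(2,3) by (simp add: le_fun_def add_mono)
          finally show ?thesis .
        qed
        have "u (x + y) - r' y \<le> u x" if "r' \<in> C" for r'
          by (rule u_ge) (use *[OF _ that] xy in \<open>auto simp: algebra_simps\<close>)
        then have "u (x + y) - u x \<le> u y"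
          by (intro u_ge) (use xy in force)+
        then show "u (x + y) \<le> u x + u y" by simp
      next
        fix t :: real and x assume t: "t > 0" and x: "x \<in> S"
        have "u (complex_of_real t *\<^sub>C x) / t \<le> u x"
        proof (rule u_ge)
          fix r assume r: "r \<in> C"
          have "u (complex_of_real t *\<^sub>C x) \<le> r (complex_of_real t *\<^sub>C x)"
            using u_le r x scaleC_mem by blast
          also have "\<dots> = t * r x" using r CA t x unfolding A_def sublinear_on_def by auto
          finally show "u (complex_of_real t *\<^sub>C x) / t \<le> r x"
            using t by (simp add: field_simps)
        qed (fact x)
        then show "u (complex_of_real t *\<^sub>C x) \<le> t * u x" using t by (simp add: field_simps)
      qed
      moreover have "u x \<le> q x" if "x \<in> S" for x
        using u_le[OF that] False CA that unfolding A_def by fastforce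
      moreover have "u \<le> a" if "a \<in> C" for a
        using u_le that CA unfolding le_fun_def A_def u_def by force
      ultimately show ?thesis unfolding A_def by (intro bexI[of _ u]) (auto simp: u_def)
    qed
  qed
  then obtain m where m: "m \<in> A" and min: "\<And>a. a \<in> A \<Longrightarrow> a \<le> m \<Longrightarrow> a = m" by blast
  show ?thesis
  proof
    show "sublinear_on S m" "\<And>x. x \<in> S \<Longrightarrow> m x \<le> q x" using m unfolding A_def by auto
    fix r x assume r: "sublinear_on S r" "\<And>x. x \<in> S \<Longrightarrow> r x \<le> m x" and x: "x \<in> S"
    have "cut r \<in> A"
      using cut_sub[OF r(1)] r(2) m unfolding A_def cut_def by (force intro: order_trans)
    moreover have "cut r \<le> m"
      using r(2) m unfolding A_def cut_def le_fun_def by auto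
    ultimately have "cut r = m" by (rule min)
    then show "r x = m x" using x by (auto simp: cut_def)
  qed
qed

text \<open>Lowering \<open>m\<close> in the direction \<open>y\<close> means passing to the infimum
  of \<open>m (x + t y) - t m y\<close> over t >= 0, which is the infimal convolution with the ray
  through \<open>(y, - m y)\<close>. Minimality forbids any decrease, so t = 1 gives
  superadditivity.\<close>

lemma minimal_sublinear_linear:
  assumes m: "sublinear_on S m"
    and min: "\<And>r x. sublinear_on S r \<Longrightarrow> (\<And>x. x \<in> S \<Longrightarrow> r x \<le> m x) \<Longrightarrow> x \<in> S \<Longrightarrow> r x = m x"
  shows "real_linear_on S m"
proof -
  have add: "m (x + y) = m x + m y" if xy: "x \<in> S" "y \<in> S" for x y
  proof -
    define P where "P = {(complex_of_real t *\<^sub>C y, - t * m y) | t. t \<ge> 0}"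
    define r where "r = (\<lambda>x. INF (w, b)\<in>P. m (x + w) + b)"
    have P: "(complex_of_real t *\<^sub>C y, - t * m y) \<in> P" if "t \<ge> 0" for t
      using that unfolding P_def by blast
    have P00: "(0, 0) \<in> P" using P[of 0] by simp
    have Padd: "(w + w', b + b') \<in> P" if "(w, b) \<in> P" "(w', b') \<in> P" for w b w' b'
    proof -
      obtain t t' where "t \<ge> 0" "t' \<ge> 0" "w = complex_of_real t *\<^sub>C y" "b = - t * m y"
        "w' = complex_of_real t' *\<^sub>C y" "b' = - t' * m y"
        using \<open>(w, b) \<in> P\<close> \<open>(w', b') \<in> P\<close> unfolding P_def by blast
      then show ?thesis using P[of "t + t'"] by (simp add: scaleC_add_left algebra_simps)
    qed
    have Pscale: "(complex_of_real s *\<^sub>C w, s * b) \<in> P" if "(w, b) \<in> P" "s > 0" for w b s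
    proof -
      obtain t where "t \<ge> 0" "w = complex_of_real t *\<^sub>C y" "b = - t * m y"
        using \<open>(w, b) \<in> P\<close> unfolding P_def by blast
      then show ?thesis using P[of "s * t"] \<open>s > 0\<close> by (simp add: scaleC_scaleC mult.assoc)
    qed
    have Pmem: "w \<in> S" "- m w \<le> b" if "(w, b) \<in> P" for w b
      using that xy(2) scaleC_mem m unfolding P_def sublinear_on_def by auto
    have r1: "sublinear_on S r" unfolding r_def
      by (rule sublinear_on_inf_cone(1)[OF m P00]) (fact Padd Pscale Pmem)+
    have r2: "r z \<le> m (z + w) + b" if "z \<in> S" "(w, b) \<in> P" for z w b unfolding r_def
      by (rule sublinear_on_inf_cone(2)[OF m P00]) (fact Padd Pscale Pmem that)+
    have "r x \<le> m (x + y) - m y" using r2[OF xy(1) P[of 1]] by simp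
    moreover have "r x = m x"
    proof (rule min)
      show "sublinear_on S r" by (fact r1)
      show "r z \<le> m z" if "z \<in> S" for z using r2[OF that P00] by simp
    qed (fact xy)
    moreover have "m (x + y) \<le> m x + m y" using m xy unfolding sublinear_on_def by blast
    ultimately show ?thesis by simp
  qed
  have neg: "m (- x) = - m x" if "x \<in> S" for x
    using add[OF that minus_mem[OF that]] sublinear_on_zero[OF m] by simp
  have "m (complex_of_real t *\<^sub>C x) = t * m x" if "x \<in> S" for t x
  proof (cases "t \<ge> 0")
    case True
    then show ?thesis using m that unfolding sublinear_on_def by blast
  next
    case False
    then have "m (complex_of_real (- t) *\<^sub>C x) = (- t) * m x"
      using m that unfolding sublinear_on_def by (meson linear neg_0_le_iff_le)
    moreover have "complex_of_real (- t) *\<^sub>C x = - (complex_of_real t *\<^sub>C x)"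
      by (simp add: scaleC_minus_left)
    ultimately show ?thesis using neg[OF scaleC_mem[OF that]] by simp
  qed
  with add show ?thesis unfolding real_linear_on_def by blast
qed

text \<open>A linear functional below the infimal convolution \<open>r\<close> meets both demands at
  once: \<open>r\<close> lies below \<open>q\<close>, and its bound \<open>b\<close> at
  \<open>- w\<close> turns into the lower bound \<open>- b\<close> at \<open>w\<close>. Below, the
  cone is an epigraph in one case and a ray in the other.\<close>

theorem Mazur_Orlicz:
  fixes P :: "('a \<times> real) set"
  assumes q: "sublinear_on S q"
    and zero: "(0, 0) \<in> P"
    and add: "\<And>w b w' b'. (w, b) \<in> P \<Longrightarrow> (w', b') \<in> P \<Longrightarrow> (w + w', b + b') \<in> P"
    and scale: "\<And>w b t. (w, b) \<in> P \<Longrightarrow> t > 0 \<Longrightarrow> (complex_of_real t *\<^sub>C w, t * b) \<in> P"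
    and mem: "\<And>w b. (w, b) \<in> P \<Longrightarrow> w \<in> S"
    and bound: "\<And>w b. (w, b) \<in> P \<Longrightarrow> - q w \<le> b"
  obtains l where "real_linear_on S l" "\<And>x. x \<in> S \<Longrightarrow> l x \<le> q x"
    "\<And>w b. (w, b) \<in> P \<Longrightarrow> - b \<le> l w"
proof -
  define r where "r = (\<lambda>x. INF (w, b)\<in>P. q (x + w) + b)"
  have r1: "sublinear_on S r" unfolding r_def
    by (rule sublinear_on_inf_cone(1)[OF q zero]) (fact add scale mem bound)+
  have r2: "r x \<le> q (x + w) + b" if "x \<in> S" "(w, b) \<in> P" for x w b unfolding r_def
    by (rule sublinear_on_inf_cone(2)[OF q zero]) (fact add scale mem bound that)+
  obtain m where m: "sublinear_on S m" "\<And>x. x \<in> S \<Longrightarrow> m x \<le> r x"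
    and min: "\<And>s x. sublinear_on S s \<Longrightarrow> (\<And>x. x \<in> S \<Longrightarrow> s x \<le> m x) \<Longrightarrow> x \<in> S \<Longrightarrow> s x = m x"
    using minimal_sublinear_exists[OF r1] by blast
  have lin: "real_linear_on S m" by (rule minimal_sublinear_linear[OF m(1)]) (fact min)
  show ?thesis
  proof
    show "real_linear_on S m" by (fact lin)
    show "m x \<le> q x" if "x \<in> S" for x
      using m(2)[OF that] r2[OF that zero] by simp
    fix w b assume P: "(w, b) \<in> P"
    have w: "w \<in> S" by (rule mem[OF P])
    have "m (- w) \<le> b"
      using m(2)[OF minus_mem[OF w]] r2[OF minus_mem[OF w] P] sublinear_on_zero[OF q] by simp
    then show "- b \<le> m w" using sublinear_on_minus[OF m(1) w] by simp
  qed
qed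

end

section \<open>Complex functionals dominated by sums of seminorms\<close>

definition complex_linear_on :: "'a::complex_vector set \<Rightarrow> ('a \<Rightarrow> complex) \<Rightarrow> bool" where
  "complex_linear_on S L \<longleftrightarrow>
     (\<forall>x\<in>S. \<forall>y\<in>S. L (x + y) = L x + L y) \<and> (\<forall>c. \<forall>x\<in>S. L (c *\<^sub>C x) = c * L x)"

lemma complex_linear_on_diff:
  assumes "complex_linear_on S L" "complex_linear_on S M"
  shows "complex_linear_on S (\<lambda>x. L x - M x)"
  using assms unfolding complex_linear_on_def by (simp add: algebra_simps)

context complex_subspace
begin

text \<open>Multiplying \<open>x\<close> by the unimodular number that makes the value of
  \<open>L\<close> real and nonnegative turns a bound on real parts into one on moduli.\<close>

lemma cmod_le_seminorm:
  assumes L: "complex_linear_on S L" and p: "seminorm_on S p"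
    and le: "\<And>x. x \<in> S \<Longrightarrow> Re (L x) \<le> p x" and x: "x \<in> S"
  shows "cmod (L x) \<le> p x"
proof (cases "L x = 0")
  case True
  have "0 \<le> p x"
    using sublinear_on_minus[OF seminorm_on_imp_sublinear_on[OF p] x] p x
      minus_mem[OF x] scaleC_minus_left[of 1 x] unfolding seminorm_on_def
    by (metis (no_types, lifting) le_minus_iff linear mult_1 neg_le_0_iff_le norm_minus_cancel
        norm_one order_trans scaleC_one_left)
  then show ?thesis using True by simp
next
  case False
  define c where "c = of_real (cmod (L x)) / L x"
  have c: "cmod c = 1" using False by (simp add: c_def norm_divide)
  have "L (c *\<^sub>C x) = of_real (cmod (L x))"
    using L x False unfolding complex_linear_on_def by (simp add: c_def)
  then have "cmod (L x) = Re (L (c *\<^sub>C x))" by simp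
  also have "\<dots> \<le> p (c *\<^sub>C x)" using le scaleC_mem x by blast
  also have "\<dots> = p x" using p x c unfolding seminorm_on_def by simp
  finally show ?thesis .
qed

text \<open>Complex linearity forces the imaginary part of a functional at x to be minus its real
  part at i x; this is where the formula for \<open>L\<close> comes from.\<close>

lemma real_linear_on_complexify:
  assumes l: "real_linear_on S l"
  defines "L \<equiv> \<lambda>x. Complex (l x) (- l (\<i> *\<^sub>C x))"
  shows "complex_linear_on S L"
  unfolding complex_linear_on_def
proof (intro conjI ballI allI)
  fix x y assume "x \<in> S" "y \<in> S"
  then show "L (x + y) = L x + L y"
    using l scaleC_mem unfolding L_def real_linear_on_def
    by (simp add: scaleC_add_right complex_eq_iff)
next
  fix c x assume x: "x \<in> S"
  have l2: "l (complex_of_real a *\<^sub>C x + complex_of_real b *\<^sub>C (\<i> *\<^sub>C x)) = a * l x + b * l (\<i> *\<^sub>C x)"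
    for a b using l x scaleC_mem unfolding real_linear_on_def by simp
  have "c *\<^sub>C x = complex_of_real (Re c) *\<^sub>C x + complex_of_real (Im c) *\<^sub>C (\<i> *\<^sub>C x)"
    unfolding scaleC_scaleC scaleC_add_left[symmetric]
    by (rule arg_cong[where f = "\<lambda>c. c *\<^sub>C x"]) (simp add: complex_eq_iff)
  then have re: "l (c *\<^sub>C x) = Re c * l x + Im c * l (\<i> *\<^sub>C x)" using l2 by simp
  have "\<i> *\<^sub>C (c *\<^sub>C x)
      = complex_of_real (- Im c) *\<^sub>C x + complex_of_real (Re c) *\<^sub>C (\<i> *\<^sub>C x)"
    unfolding scaleC_scaleC scaleC_add_left[symmetric]
    by (rule arg_cong[where f = "\<lambda>c. c *\<^sub>C x"]) (simp add: complex_eq_iff)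
  then have im: "l (\<i> *\<^sub>C (c *\<^sub>C x)) = - Im c * l x + Re c * l (\<i> *\<^sub>C x)"
    using l2[of "- Im c" "Re c"] by simp
  show "L (c *\<^sub>C x) = c * L x"
    unfolding L_def re im by (simp add: complex_eq_iff algebra_simps)
qed

text \<open>The cone is the epigraph of \<open>q - Re \<phi>\<close>, so the lower bound of
  Mazur-Orlicz reads \<open>Re \<phi> - l \<le> q\<close>, next to \<open>l \<le> p\<close>. The
  assumption on \<open>\<phi>\<close> is what makes the cone compatible with \<open>p\<close>.
  Complexifying \<open>l\<close> and rotating then gives the bounds on moduli.\<close>

theorem seminorm_decomposition:
  assumes \<phi>: "complex_linear_on S \<phi>" and p: "seminorm_on S p" and q: "seminorm_on S q"
    and le: "\<And>x. x \<in> S \<Longrightarrow> cmod (\<phi> x) \<le> p x + q x"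
  obtains \<psi> where "complex_linear_on S \<psi>" "\<And>x. x \<in> S \<Longrightarrow> cmod (\<psi> x) \<le> p x"
    "\<And>x. x \<in> S \<Longrightarrow> cmod (\<phi> x - \<psi> x) \<le> q x"
proof -
  define P where "P = {(w, b). w \<in> S \<and> q w - Re (\<phi> w) \<le> b}"
  have \<phi>_add: "\<phi> (x + y) = \<phi> x + \<phi> y" if "x \<in> S" "y \<in> S" for x y
    using \<phi> that unfolding complex_linear_on_def by blast
  have \<phi>_scale: "\<phi> (c *\<^sub>C x) = c * \<phi> x" if "x \<in> S" for c x
    using \<phi> that unfolding complex_linear_on_def by blast
  obtain l where l: "real_linear_on S l" and l_le: "\<And>x. x \<in> S \<Longrightarrow> l x \<le> p x"
    and l_ge: "\<And>w b. (w, b) \<in> P \<Longrightarrow> - b \<le> l w"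
  proof (rule Mazur_Orlicz[of p P])
    show "sublinear_on S p" by (rule seminorm_on_imp_sublinear_on[OF p])
    show "(0, 0) \<in> P"
      using sublinear_on_zero[OF seminorm_on_imp_sublinear_on[OF q]] zero_mem \<phi>_scale[of 0 0]
      unfolding P_def by simp
    fix w b assume P: "(w, b) \<in> P"
    show "w \<in> S" using P unfolding P_def by simp
    show "- p w \<le> b"
      using P le[of w] complex_Re_le_cmod[of "\<phi> w"] unfolding P_def by simp
    show "(complex_of_real t *\<^sub>C w, t * b) \<in> P" if "t > 0" for t
      using P that q \<phi>_scale scaleC_mem unfolding P_def seminorm_on_def
      by (simp add: right_diff_distrib[symmetric] del: of_real_mult)
    fix w' b' assume P': "(w', b') \<in> P"
    have "q (w + w') \<le> q w + q w'" using q P P' unfolding P_def seminorm_on_def by auto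
    then show "(w + w', b + b') \<in> P"
      using P P' \<phi>_add add_mem unfolding P_def by auto
  qed blast
  define \<psi> where "\<psi> = (\<lambda>x. Complex (l x) (- l (\<i> *\<^sub>C x)))"
  have \<psi>: "complex_linear_on S \<psi>"
    unfolding \<psi>_def by (rule real_linear_on_complexify[OF l])
  show ?thesis
  proof
    show "complex_linear_on S \<psi>" by (fact \<psi>)
    show "cmod (\<psi> x) \<le> p x" if "x \<in> S" for x
      by (rule cmod_le_seminorm[OF \<psi> p _ that]) (simp add: \<psi>_def l_le)
    show "cmod (\<phi> x - \<psi> x) \<le> q x" if "x \<in> S" for x
    proof (rule cmod_le_seminorm[OF complex_linear_on_diff[OF \<phi> \<psi>] q _ that])
      fix z assume "z \<in> S"
      then have "(z, q z - Re (\<phi> z)) \<in> P" unfolding P_def by simp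
      from l_ge[OF this] show "Re (\<phi> z - \<psi> z) \<le> q z" by (simp add: \<psi>_def)
    qed
  qed
qed

text \<open>One seminorm is split off at a time; \<open>q\<close> and the remaining summands
  together play the part of the second seminorm.\<close>

corollary seminorm_decomposition_sum:
  assumes "finite I" and "complex_linear_on S \<phi>" and "seminorm_on S q"
    and "\<And>i. i \<in> I \<Longrightarrow> seminorm_on S (p i)"
    and "\<And>x. x \<in> S \<Longrightarrow> cmod (\<phi> x) \<le> q x + (\<Sum>i\<in>I. p i x)"
  shows "\<exists>\<psi>. (\<forall>i\<in>I. complex_linear_on S (\<psi> i) \<and> (\<forall>x\<in>S. cmod (\<psi> i x) \<le> p i x)) \<and>
    (\<forall>x\<in>S. cmod (\<phi> x - (\<Sum>i\<in>I. \<psi> i x)) \<le> q x)"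
  using assms
proof (induction I arbitrary: \<phi> rule: finite_induct)
  case empty
  then show ?case by simp
next
  case (insert j I)
  have q': "seminorm_on S (\<lambda>x. q x + (\<Sum>i\<in>I. p i x))"
    using insert by (intro seminorm_on_add seminorm_on_sum) auto
  have pj: "seminorm_on S (p j)" using insert by simp
  have le: "cmod (\<phi> x) \<le> p j x + (q x + (\<Sum>i\<in>I. p i x))" if "x \<in> S" for x
    using insert.prems(4)[OF that] insert.hyps by (simp add: algebra_simps)
  obtain \<rho> where \<rho>: "complex_linear_on S \<rho>" "\<And>x. x \<in> S \<Longrightarrow> cmod (\<rho> x) \<le> p j x"
    "\<And>x. x \<in> S \<Longrightarrow> cmod (\<phi> x - \<rho> x) \<le> q x + (\<Sum>i\<in>I. p i x)"
    using seminorm_decomposition[OF insert.prems(1) pj q' le] by blast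
  obtain \<psi> where \<psi>: "\<forall>i\<in>I. complex_linear_on S (\<psi> i) \<and> (\<forall>x\<in>S. cmod (\<psi> i x) \<le> p i x)"
    "\<forall>x\<in>S. cmod ((\<phi> x - \<rho> x) - (\<Sum>i\<in>I. \<psi> i x)) \<le> q x"
    using insert.IH[OF complex_linear_on_diff[OF insert.prems(1) \<rho>(1)] insert.prems(2) _ \<rho>(3)]
      insert.prems(3) by auto
  define \<psi>' where "\<psi>' = \<psi>(j := \<rho>)"
  have "(\<Sum>i\<in>I. \<psi>' i x) = (\<Sum>i\<in>I. \<psi> i x)" for x
    using insert.hyps by (intro sum.cong) (auto simp: \<psi>'_def)
  then have "(\<Sum>i\<in>insert j I. \<psi>' i x) = \<rho> x + (\<Sum>i\<in>I. \<psi> i x)" for x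
    using insert.hyps by (simp add: \<psi>'_def)
  then show ?case
    using \<psi> \<rho> insert.hyps by (intro exI[of _ \<psi>']) (auto simp: \<psi>'_def diff_diff_eq)
qed

end

section \<open>Norming functionals on a normed space\<close>

lemma complex_subspace_UNIV: "complex_subspace UNIV"
  by unfold_locales auto

lemma seminorm_on_norm: "seminorm_on S (norm :: 'a::complex_normed_vector \<Rightarrow> real)"
  unfolding seminorm_on_def by (simp add: norm_triangle_ineq norm_scaleC)

theorem norming_functional:
  fixes z :: "'a::complex_normed_vector"
  obtains L where "complex_linear_on UNIV L" "\<And>x. cmod (L x) \<le> norm x" "L z = of_real (norm z)"
proof -
  interpret complex_subspace "UNIV :: 'a set" by (rule complex_subspace_UNIV)
  \<comment> \<open>On this ray the constraint of Mazur-Orlicz says that \<open>l\<close> is at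
    least \<open>t * norm z\<close> at t z, so the upper bound \<open>norm\<close> is attained at
    \<open>z\<close>.\<close>
  define P where "P = {(complex_of_real t *\<^sub>C z, - t * norm z) | t. t \<ge> 0}"
  have P: "(complex_of_real t *\<^sub>C z, - t * norm z) \<in> P" if "t \<ge> 0" for t
    using that unfolding P_def by blast
  obtain l where l: "real_linear_on UNIV l" and l_le: "\<And>x. l x \<le> norm x"
    and l_ge: "\<And>w b. (w, b) \<in> P \<Longrightarrow> - b \<le> l w"
  proof (rule Mazur_Orlicz[of norm P])
    show "sublinear_on UNIV (norm :: 'a \<Rightarrow> real)"
      by (rule seminorm_on_imp_sublinear_on[OF seminorm_on_norm])
    show "(0, 0) \<in> P" using P[of 0] by simp
    fix w b assume "(w, b) \<in> P"
    then obtain t where t: "t \<ge> 0" "w = complex_of_real t *\<^sub>C z" "b = - t * norm z"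
      unfolding P_def by blast
    show "- norm w \<le> b" using t by (simp add: norm_scaleC)
    show "(complex_of_real s *\<^sub>C w, s * b) \<in> P" if "s > 0" for s
      using P[of "s * t"] t that by (simp add: scaleC_scaleC mult.assoc)
    fix w' b' assume "(w', b') \<in> P"
    then obtain t' where "t' \<ge> 0" "w' = complex_of_real t' *\<^sub>C z" "b' = - t' * norm z"
      unfolding P_def by blast
    then show "(w + w', b + b') \<in> P"
      using t P[of "t + t'"] by (simp add: scaleC_add_left algebra_simps)
  qed simp_all
  define L where "L = (\<lambda>x. Complex (l x) (- l (\<i> *\<^sub>C x)))"
  have L: "complex_linear_on UNIV L"
    unfolding L_def by (rule real_linear_on_complexify[OF l])
  have bound: "cmod (L x) \<le> norm x" for x
    by (rule cmod_le_seminorm[OF L seminorm_on_norm]) (simp_all add: L_def l_le)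
  have "norm z \<le> Re (L z)" using l_ge[OF P[of 1]] by (simp add: L_def)
  \<comment> \<open>The real part alone already exhausts the bound on the modulus, so the imaginary
    part must vanish.\<close>
  moreover have "(Re (L z))\<^sup>2 + (Im (L z))\<^sup>2 \<le> (norm z)\<^sup>2"
    using bound[of z] by (metis cmod_power2 norm_ge_zero power_mono)
  moreover have "Re (L z) \<le> norm z" using bound[of z] complex_Re_le_cmod[of "L z"] by simp
  ultimately have "Re (L z) = norm z" "(Im (L z))\<^sup>2 \<le> 0" by simp_all
  then have "L z = of_real (norm z)" by (simp add: complex_eq_iff)
  with L bound that show ?thesis by blast
qed

section \<open>Bounded operators between seminormed spaces\<close>

locale seminormed_space = complex_subspace "carrier X"
  for X :: "'a::complex_vector nvs" +
  assumes seminorm: "seminorm_on (carrier X) (nrm X)"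
begin

lemma nrm_add: "x \<in> carrier X \<Longrightarrow> y \<in> carrier X \<Longrightarrow> nrm X (x + y) \<le> nrm X x + nrm X y"
  using seminorm unfolding seminorm_on_def by blast

lemma nrm_scaleC: "x \<in> carrier X \<Longrightarrow> nrm X (c *\<^sub>C x) = cmod c * nrm X x"
  using seminorm unfolding seminorm_on_def by blast

lemma nrm_zero: "nrm X 0 = 0"
  using nrm_scaleC[OF zero_mem, of 0] by simp

lemma nrm_minus: "x \<in> carrier X \<Longrightarrow> nrm X (- x) = nrm X x"
  using nrm_scaleC[of x "-1"] by (simp add: scaleC_minus_left)

lemma nrm_nonneg: "x \<in> carrier X \<Longrightarrow> 0 \<le> nrm X x"
  using nrm_add[of x "- x"] nrm_minus[of x] minus_mem nrm_zero by simp

lemma nrm_diff: "x \<in> carrier X \<Longrightarrow> y \<in> carrier X \<Longrightarrow> nrm X (x - y) \<le> nrm X x + nrm X y"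
  using nrm_add[of x "- y"] nrm_minus[of y] minus_mem by simp

lemma zero_in_unit_ball: "0 \<in> unit_ball X"
  unfolding unit_ball_def using zero_mem nrm_zero by simp

end

lemma seminormed_space_whole: "seminormed_space (whole_space :: 'a::complex_normed_vector nvs)"
  unfolding whole_space_def
  by unfold_locales (auto simp: seminorm_on_norm)

lemma whole_space_simps [simp]: "carrier whole_space = UNIV" "nrm whole_space = norm"
  unfolding whole_space_def by simp_all

locale operator_space = X: seminormed_space X + Y: seminormed_space Y
  for X :: "'a::complex_vector nvs" and Y :: "'b::complex_vector nvs"
begin

abbreviation "ops \<equiv> bounded_ops X Y"

lemma ops_iff:
  "T \<in> carrier ops \<longleftrightarrow> linear_between X Y T \<and>
     (\<exists>B. \<forall>x\<in>carrier X. nrm Y (T x) \<le> B * nrm X x) \<and> (\<forall>x. x \<notin> carrier X \<longrightarrow> T x = 0)"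
  unfolding bounded_ops_def by simp

lemma ops_mem: "T \<in> carrier ops \<Longrightarrow> x \<in> carrier X \<Longrightarrow> T x \<in> carrier Y"
  and ops_add: "T \<in> carrier ops \<Longrightarrow> x \<in> carrier X \<Longrightarrow> y \<in> carrier X \<Longrightarrow> T (x + y) = T x + T y"
  and ops_scaleC: "T \<in> carrier ops \<Longrightarrow> x \<in> carrier X \<Longrightarrow> T (c *\<^sub>C x) = c *\<^sub>C T x"
  and ops_outside: "T \<in> carrier ops \<Longrightarrow> x \<notin> carrier X \<Longrightarrow> T x = 0"
  unfolding ops_iff linear_between_def by auto

lemma ops_zero: "T \<in> carrier ops \<Longrightarrow> T 0 = 0"
  using ops_scaleC[of T 0 0] X.zero_mem by simp

lemma ops_minus: "T \<in> carrier ops \<Longrightarrow> x \<in> carrier X \<Longrightarrow> T (- x) = - T x"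
  using ops_scaleC[of T x "-1"] by (simp add: scaleC_minus_left)

lemma ops_diff:
  "T \<in> carrier ops \<Longrightarrow> x \<in> carrier X \<Longrightarrow> y \<in> carrier X \<Longrightarrow> T (x - y) = T x - T y"
  using ops_add[of T x "- y"] ops_minus X.minus_mem by simp

lemma ops_sum:
  "T \<in> carrier ops \<Longrightarrow> (\<And>i. i \<in> I \<Longrightarrow> f i \<in> carrier X) \<Longrightarrow> T (sum f I) = (\<Sum>i\<in>I. T (f i))"
  by (induction I rule: infinite_finite_induct) (auto simp: ops_zero ops_add X.sum_mem)

lemma opsI:
  assumes "\<And>x. x \<in> carrier X \<Longrightarrow> T x \<in> carrier Y"
    and "\<And>x y. x \<in> carrier X \<Longrightarrow> y \<in> carrier X \<Longrightarrow> T (x + y) = T x + T y"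
    and "\<And>c x. x \<in> carrier X \<Longrightarrow> T (c *\<^sub>C x) = c *\<^sub>C T x"
    and "\<And>x. x \<in> carrier X \<Longrightarrow> nrm Y (T x) \<le> B * nrm X x"
    and "\<And>x. x \<notin> carrier X \<Longrightarrow> T x = 0"
  shows "T \<in> carrier ops"
  using assms unfolding ops_iff linear_between_def by blast

lemma bdd_above_ops:
  assumes "T \<in> carrier ops"
  shows "bdd_above ((\<lambda>x. nrm Y (T x)) ` unit_ball X)"
proof -
  obtain B where B: "\<And>x. x \<in> carrier X \<Longrightarrow> nrm Y (T x) \<le> B * nrm X x"
    using assms unfolding ops_iff by blast
  have "nrm Y (T x) \<le> \<bar>B\<bar>" if "x \<in> unit_ball X" for x
  proof -
    have x: "x \<in> carrier X" "nrm X x \<le> 1" using that unfolding unit_ball_def by auto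
    have "nrm Y (T x) \<le> B * nrm X x" by (rule B[OF x(1)])
    also have "\<dots> \<le> \<bar>B\<bar> * 1" using x X.nrm_nonneg by (intro mult_mono) auto
    finally show ?thesis by simp
  qed
  then show ?thesis by (auto intro!: bdd_aboveI2)
qed

lemma ops_le_unit_ball:
  assumes "T \<in> carrier ops" "x \<in> unit_ball X"
  shows "nrm Y (T x) \<le> nrm ops T"
  using cSUP_upper[OF assms(2) bdd_above_ops[OF assms(1)]] unfolding bounded_ops_def by simp

lemma nrm_ops_nonneg: "T \<in> carrier ops \<Longrightarrow> 0 \<le> nrm ops T"
  using ops_le_unit_ball[of T 0] X.zero_in_unit_ball ops_zero[of T] Y.nrm_zero by simp

lemma nrm_ops_bound:
  assumes T: "T \<in> carrier ops" and x: "x \<in> carrier X"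
  shows "nrm Y (T x) \<le> nrm ops T * nrm X x"
proof (cases "nrm X x = 0")
  case True
  \<comment> \<open>A vector of seminorm 0 cannot be normalized; here the constant \<open>B\<close>
    from \<open>bounded_ops\<close> shows that its image has norm at most 0.\<close>
  then show ?thesis using T x unfolding ops_iff by fastforce
next
  case False
  then have n: "nrm X x > 0" using X.nrm_nonneg[OF x] by simp
  define c where "c = complex_of_real (inverse (nrm X x))"
  have "c *\<^sub>C x \<in> unit_ball X"
    unfolding unit_ball_def using x n by (simp add: X.nrm_scaleC X.scaleC_mem c_def norm_inverse)
  then have "nrm Y (c *\<^sub>C T x) \<le> nrm ops T"
    using ops_le_unit_ball[OF T] ops_scaleC[OF T x] by metis
  then show ?thesis
    using n ops_mem[OF T x] by (simp add: Y.nrm_scaleC c_def norm_divide field_simps)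
qed

lemma nrm_ops_le:
  assumes "0 \<le> c" "\<And>x. x \<in> carrier X \<Longrightarrow> nrm Y (T x) \<le> c * nrm X x"
  shows "nrm ops T \<le> c"
proof -
  have "nrm Y (T x) \<le> c" if "x \<in> unit_ball X" for x
  proof -
    have x: "x \<in> carrier X" "nrm X x \<le> 1" using that unfolding unit_ball_def by auto
    have "nrm Y (T x) \<le> c * nrm X x" by (rule assms(2)[OF x(1)])
    also have "\<dots> \<le> c" using x assms(1) by (simp add: mult_left_le)
    finally show ?thesis .
  qed
  then show ?thesis unfolding bounded_ops_def
    using X.zero_in_unit_ball by (auto intro!: cSUP_least)
qed

lemma ops_add_mem:
  assumes "T \<in> carrier ops" "R \<in> carrier ops"
  shows "T + R \<in> carrier ops" "nrm ops (T + R) \<le> nrm ops T + nrm ops R"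
proof -
  have bound: "nrm Y ((T + R) x) \<le> (nrm ops T + nrm ops R) * nrm X x" if x: "x \<in> carrier X" for x
    using Y.nrm_add[OF ops_mem[OF assms(1) x] ops_mem[OF assms(2) x]]
      nrm_ops_bound[OF assms(1) x] nrm_ops_bound[OF assms(2) x]
    by (simp add: distrib_right)
  show "T + R \<in> carrier ops"
    by (rule opsI[OF _ _ _ bound])
      (simp_all add: assms ops_mem ops_add ops_scaleC ops_outside Y.add_mem scaleC_add_right)
  show "nrm ops (T + R) \<le> nrm ops T + nrm ops R"
    by (rule nrm_ops_le[OF _ bound]) (simp_all add: assms nrm_ops_nonneg)
qed

lemma ops_scaleC_mem:
  assumes T: "T \<in> carrier ops"
  shows "c *\<^sub>C T \<in> carrier ops" "nrm ops (c *\<^sub>C T) \<le> cmod c * nrm ops T"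
proof -
  have bound: "nrm Y ((c *\<^sub>C T) x) \<le> (cmod c * nrm ops T) * nrm X x" if x: "x \<in> carrier X" for x
    using nrm_ops_bound[OF T x] ops_mem[OF T x]
    by (simp add: scaleC_fun_def Y.nrm_scaleC mult.assoc mult_left_mono)
  show "c *\<^sub>C T \<in> carrier ops"
    by (rule opsI[OF _ _ _ bound])
      (simp_all add: scaleC_fun_def T ops_mem ops_add ops_scaleC ops_outside Y.scaleC_mem
        scaleC_add_right scaleC_scaleC mult.commute)
  show "nrm ops (c *\<^sub>C T) \<le> cmod c * nrm ops T"
    by (rule nrm_ops_le[OF _ bound]) (simp_all add: T nrm_ops_nonneg)
qed

lemma seminormed_space_ops: "seminormed_space ops"
proof
  show "0 \<in> carrier ops"
    by (rule opsI[where B = 0]) (simp_all add: Y.zero_mem Y.nrm_zero)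
  show "T + R \<in> carrier ops" if "T \<in> carrier ops" "R \<in> carrier ops" for T R
    using ops_add_mem[OF that] by simp
  show "c *\<^sub>C T \<in> carrier ops" if "T \<in> carrier ops" for c T
    using ops_scaleC_mem[OF that] by simp
  have "nrm ops (c *\<^sub>C T) = cmod c * nrm ops T" if T: "T \<in> carrier ops" for c T
  proof (cases "c = 0")
    case True
    have "nrm ops (0 *\<^sub>C T) \<le> 0" using ops_scaleC_mem(2)[OF T, of 0] by simp
    then show ?thesis using True nrm_ops_nonneg[OF ops_scaleC_mem(1)[OF T, of 0]] by simp
  next
    case False
    have "nrm ops T = nrm ops (inverse c *\<^sub>C (c *\<^sub>C T))" using False by (simp add: scaleC_scaleC)
    also have "\<dots> \<le> cmod (inverse c) * nrm ops (c *\<^sub>C T)"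
      by (rule ops_scaleC_mem(2)[OF ops_scaleC_mem(1)[OF T]])
    finally have "cmod c * nrm ops T \<le> nrm ops (c *\<^sub>C T)"
      using False by (simp add: norm_divide field_simps)
    then show ?thesis using ops_scaleC_mem(2)[OF T, of c] by simp
  qed
  then show "seminorm_on (carrier ops) (nrm ops)"
    unfolding seminorm_on_def using ops_add_mem by auto
qed

lemma ops_eqI:
  assumes "T \<in> carrier ops" "R \<in> carrier ops" "\<And>x. x \<in> carrier X \<Longrightarrow> T x = R x"
  shows "T = R"
  using assms ops_outside by (metis ext)

end

lemma operator_space_whole:
  "seminormed_space X \<Longrightarrow> operator_space X (whole_space :: 'b::complex_normed_vector nvs)"
  by (simp add: operator_space_def seminormed_space_whole)

section \<open>Weighted spaces of holomorphic mappings\<close>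

lemma bounded_linear_of_complex_linear:
  fixes L :: "'a::complex_normed_vector \<Rightarrow> 'b::complex_normed_vector"
  assumes "\<And>x y. L (x + y) = L x + L y" "\<And>c x. L (c *\<^sub>C x) = c *\<^sub>C L x"
    and "\<And>x. norm (L x) \<le> K * norm x"
  shows "bounded_linear L"
  by (rule bounded_linear_intro[where K = K])
    (simp_all add: assms scaleR_scaleC mult.commute)

lemma bounded_linear_scaleC_left:
  "bounded_linear (\<lambda>c. c *\<^sub>C (x::'a::complex_normed_vector))"
  by (rule bounded_linear_of_complex_linear[where K = "norm x"])
    (simp_all add: scaleC_add_left scaleC_scaleC scaleC_complex_def mult.commute norm_scaleC)

lemma holomorphic_map_on_zero: "holomorphic_map_on 0 U"
  unfolding holomorphic_map_on_def zero_fun_def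
  by (auto intro!: exI[of _ "\<lambda>_. 0"])

lemma holomorphic_map_on_add:
  assumes "holomorphic_map_on f U" "holomorphic_map_on g U"
  shows "holomorphic_map_on (f + g) U"
  unfolding holomorphic_map_on_def
proof
  fix x assume "x \<in> U"
  then obtain D D' where "(f has_derivative D) (at x)" "\<And>c h. D (c *\<^sub>C h) = c *\<^sub>C D h"
    "(g has_derivative D') (at x)" "\<And>c h. D' (c *\<^sub>C h) = c *\<^sub>C D' h"
    using assms unfolding holomorphic_map_on_def by blast
  then show "\<exists>D. (f + g has_derivative D) (at x) \<and> (\<forall>c h. D (c *\<^sub>C h) = c *\<^sub>C D h)"
    unfolding plus_fun_def
    by (intro exI[of _ "\<lambda>h. D h + D' h"]) (auto simp: scaleC_add_right intro: has_derivative_add)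
qed

lemma holomorphic_map_on_compose_linear:
  fixes L :: "'a::complex_normed_vector \<Rightarrow> 'b::complex_normed_vector"
  assumes f: "holomorphic_map_on f U"
    and L: "bounded_linear L" "\<And>c x. L (c *\<^sub>C x) = c *\<^sub>C L x"
  shows "holomorphic_map_on (\<lambda>x. L (f x)) U"
  unfolding holomorphic_map_on_def
proof
  fix x assume "x \<in> U"
  then obtain D where "(f has_derivative D) (at x)" "\<And>c h. D (c *\<^sub>C h) = c *\<^sub>C D h"
    using f unfolding holomorphic_map_on_def by blast
  then show "\<exists>D. ((\<lambda>x. L (f x)) has_derivative D) (at x) \<and> (\<forall>c h. D (c *\<^sub>C h) = c *\<^sub>C D h)"
    by (intro exI[of _ "\<lambda>h. L (D h)"])
      (auto simp: L(2) intro: bounded_linear.has_derivative[OF L(1)])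
qed

lemma holomorphic_second_order:
  assumes u: "u holomorphic_on ball 0 R" and R: "R > 0"
    and M: "\<And>z. z \<in> ball 0 R \<Longrightarrow> cmod (u z) \<le> M"
  shows "cmod (deriv u 0) \<le> 4 * M / R"
    and "z \<in> ball 0 (R / 2) \<Longrightarrow> cmod (u z - u 0 - deriv u 0 * z) \<le> 32 * M / R\<^sup>2 * (cmod z)\<^sup>2"
proof -
  \<comment> \<open>Around each point of the half-radius disc a closed disc of radius
    \<open>R / 4\<close> still fits into the domain. Cauchy's inequality on it produces the
    constants: 4 for n = 1, and 2 * 16 = 32 for n = 2.\<close>
  have *: "norm ((deriv ^^ n) u w) \<le> fact n * M / (R / 4) ^ n" if w: "w \<in> ball 0 (R / 2)" for n w
  proof (rule Cauchy_inequality)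
    have sub: "cball w (R / 4) \<subseteq> ball 0 R"
    proof
      fix z assume "z \<in> cball w (R / 4)"
      then show "z \<in> ball 0 R"
        using w R norm_triangle_ineq2[of z w] by (simp add: dist_norm norm_minus_commute)
    qed
    show "u holomorphic_on ball w (R / 4)"
      using u sub by (meson ball_subset_cball holomorphic_on_subset order_trans)
    show "continuous_on (cball w (R / 4)) u"
      using u sub by (meson holomorphic_on_imp_continuous_on continuous_on_subset)
    show "0 < R / 4" using R by simp
    show "norm (u x) \<le> M" if "norm (w - x) = R / 4" for x
      by (rule M) (use sub that in \<open>auto simp: dist_norm\<close>)
  qed
  show "cmod (deriv u 0) \<le> 4 * M / R"
    using *[of 0 1] R by (simp add: mult.commute)
  assume z: "z \<in> ball 0 (R / 2)"
  \<comment> \<open>\<open>complex_Taylor\<close> of degree 1 divides its remainder by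
    \<open>fact 1\<close>, so the constant 32 is not halved.\<close>
  have "cmod ((deriv ^^ 0) u z - (\<Sum>i\<le>1. (deriv ^^ i) u 0 * (z - 0) ^ i / fact i))
      \<le> (32 * M / R\<^sup>2) * cmod (z - 0) ^ Suc 1 / fact 1"
  proof (rule complex_Taylor[where S = "ball 0 (R / 2)"])
    fix i x assume x: "x \<in> ball (0::complex) (R / 2)"
    have "(deriv ^^ i) u holomorphic_on ball 0 R"
      using u by (intro holomorphic_higher_deriv) auto
    moreover have "x \<in> ball 0 R" using x R by simp
    ultimately have "((deriv ^^ i) u has_field_derivative (deriv ^^ Suc i) u x) (at x)"
      by (metis (no_types, lifting) comp_apply funpow.simps(2) holomorphic_derivI open_ball)
    then show "((deriv ^^ i) u has_field_derivative (deriv ^^ Suc i) u x) (at x within ball 0 (R / 2))"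
      by (rule has_field_derivative_at_within)
  next
    fix x assume "x \<in> ball (0::complex) (R / 2)"
    from *[OF this, of "Suc 1"] show "cmod ((deriv ^^ Suc 1) u x) \<le> 32 * M / R\<^sup>2"
      by (simp add: power2_eq_square mult.assoc fact_2 numeral_2_eq_2)
  qed (use z R in auto)
  then show "cmod (u z - u 0 - deriv u 0 * z) \<le> 32 * M / R\<^sup>2 * (cmod z)\<^sup>2"
    by (simp add: diff_diff_eq power2_eq_square)
qed

locale weighted_domain =
  fixes U :: "'e::complex_normed_vector set" and v :: "'e \<Rightarrow> real"
  assumes open_U: "open U" and weight: "weight_on U v"
begin

lemma v_pos: "x \<in> U \<Longrightarrow> 0 < v x"
  using weight unfolding weight_on_def by blast

lemma Hv_iff:
  "f \<in> carrier (Hv U v) \<longleftrightarrow> holomorphic_map_on f U \<and> bdd_above ((\<lambda>x. v x * norm (f x)) ` U) \<and>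
     (\<forall>x. x \<notin> U \<longrightarrow> f x = 0)"
  unfolding Hv_def by simp

lemma HvI:
  assumes "holomorphic_map_on f U" "\<And>x. x \<in> U \<Longrightarrow> v x * norm (f x) \<le> B" "\<And>x. x \<notin> U \<Longrightarrow> f x = 0"
  shows "f \<in> carrier (Hv U v)"
  using assms unfolding Hv_iff by (auto intro!: bdd_aboveI2)

lemma Hv_bound:
  assumes "f \<in> carrier (Hv U v)" "x \<in> U" shows "v x * norm (f x) \<le> nrm (Hv U v) f"
  using assms unfolding Hv_def by (auto intro!: cSup_upper)

lemma Hv_nrm_nonneg: "f \<in> carrier (Hv U v) \<Longrightarrow> 0 \<le> nrm (Hv U v) f"
  unfolding Hv_def by (auto intro!: cSup_upper)

lemma Hv_nrm_le:
  assumes "0 \<le> c" "\<And>x. x \<in> U \<Longrightarrow> v x * norm (f x) \<le> c" shows "nrm (Hv U v) f \<le> c"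
  unfolding Hv_def using assms by (auto intro!: cSup_least)

lemma Hv_outside: "f \<in> carrier (Hv U v) \<Longrightarrow> x \<notin> U \<Longrightarrow> f x = 0"
  unfolding Hv_iff by blast

lemma Hv_compose_linear:
  fixes L :: "'a::complex_normed_vector \<Rightarrow> 'b::complex_normed_vector"
  assumes f: "f \<in> carrier (Hv U v)"
    and L: "\<And>x y. L (x + y) = L x + L y" "\<And>c x. L (c *\<^sub>C x) = c *\<^sub>C L x"
    and K: "\<And>x. norm (L x) \<le> K * norm x" "0 \<le> K"
  shows "(\<lambda>x. L (f x)) \<in> carrier (Hv U v)" "nrm (Hv U v) (\<lambda>x. L (f x)) \<le> K * nrm (Hv U v) f"
proof -
  have bound: "v x * norm (L (f x)) \<le> K * nrm (Hv U v) f" if "x \<in> U" for x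
  proof -
    have "v x * norm (L (f x)) \<le> v x * (K * norm (f x))"
      using v_pos[OF that] K by (intro mult_left_mono) auto
    also have "\<dots> = K * (v x * norm (f x))" by simp
    also have "\<dots> \<le> K * nrm (Hv U v) f" by (intro mult_left_mono Hv_bound f that K)
    finally show ?thesis .
  qed
  have "L 0 = 0" using L(2)[of 0 0] by simp
  moreover have "holomorphic_map_on (\<lambda>x. L (f x)) U"
    by (rule holomorphic_map_on_compose_linear[OF _ bounded_linear_of_complex_linear[OF L K(1)] L(2)])
      (use f Hv_iff in blast)
  ultimately show "(\<lambda>x. L (f x)) \<in> carrier (Hv U v)"
    using Hv_outside[OF f] by (intro HvI[OF _ bound]) simp_all
  show "nrm (Hv U v) (\<lambda>x. L (f x)) \<le> K * nrm (Hv U v) f"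
    by (rule Hv_nrm_le) (simp_all add: bound K Hv_nrm_nonneg f)
qed

lemma seminormed_space_Hv:
  "seminormed_space (Hv U v :: ('e \<Rightarrow> 'f::complex_normed_vector) nvs)"
proof
  let ?H = "Hv U v :: ('e \<Rightarrow> 'f) nvs"
  show "0 \<in> carrier ?H"
    by (rule HvI[where B = 0]) (simp_all add: holomorphic_map_on_zero)
  have add: "f + g \<in> carrier ?H \<and> nrm ?H (f + g) \<le> nrm ?H f + nrm ?H g"
    if fg: "f \<in> carrier ?H" "g \<in> carrier ?H" for f g
  proof -
    have bound: "v x * norm ((f + g) x) \<le> nrm ?H f + nrm ?H g" if "x \<in> U" for x
    proof -
      have "v x * norm ((f + g) x) \<le> v x * (norm (f x) + norm (g x))"
        using v_pos[OF that] by (intro mult_left_mono) (auto simp: norm_triangle_ineq)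
      then show ?thesis
        using Hv_bound[OF fg(1) that] Hv_bound[OF fg(2) that] by (simp add: distrib_left)
    qed
    moreover have "f + g \<in> carrier ?H"
      using fg by (intro HvI[OF _ bound] holomorphic_map_on_add) (auto simp: Hv_iff)
    ultimately show ?thesis
      using fg by (auto intro!: Hv_nrm_le add_nonneg_nonneg Hv_nrm_nonneg)
  qed
  then show "f + g \<in> carrier ?H" if "f \<in> carrier ?H" "g \<in> carrier ?H" for f g
    using that by blast
  have scale: "c *\<^sub>C f \<in> carrier ?H \<and> nrm ?H (c *\<^sub>C f) \<le> cmod c * nrm ?H f"
    if f: "f \<in> carrier ?H" for c f
    using Hv_compose_linear[OF f, where L = "\<lambda>y. c *\<^sub>C y" and K = "cmod c"]
    by (simp add: scaleC_fun_def scaleC_add_right scaleC_scaleC mult.commute norm_scaleC)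
  then show "c *\<^sub>C f \<in> carrier ?H" if "f \<in> carrier ?H" for c f
    using that by blast
  have "nrm ?H (c *\<^sub>C f) = cmod c * nrm ?H f" if f: "f \<in> carrier ?H" for c f
  proof (cases "c = 0")
    case True
    then show ?thesis
      using scale[OF f, of 0] Hv_nrm_nonneg[of "0 *\<^sub>C f"] by simp
  next
    case False
    have "nrm ?H f \<le> cmod (inverse c) * nrm ?H (c *\<^sub>C f)"
      using scale[of "c *\<^sub>C f" "inverse c"] scale[OF f, of c] False
      by (simp add: scaleC_scaleC)
    then have "cmod c * nrm ?H f \<le> nrm ?H (c *\<^sub>C f)"
      using False by (simp add: norm_divide field_simps)
    then show ?thesis using scale[OF f, of c] by simp
  qed
  with add show "seminorm_on (carrier ?H) (nrm ?H)"
    unfolding seminorm_on_def by blast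
qed

sublocale H: operator_space "Hv U v :: ('e \<Rightarrow> complex) nvs" "whole_space :: complex nvs"
  by (rule operator_space_whole[OF seminormed_space_Hv])

abbreviation "H \<equiv> Hv U v :: ('e \<Rightarrow> complex) nvs"

lemma dual_H: "dual H = bounded_ops H whole_space"
  by (simp add: dual_def)

section \<open>Local estimates that are uniform over the unit ball of \<open>H\<close>\<close>

lemma has_derivative_frechet:
  assumes g: "g \<in> carrier (Hv U v)" and x: "x \<in> U"
  shows "(g has_derivative frechet_derivative g (at x)) (at x)"
    and "frechet_derivative g (at x) (c *\<^sub>C h) = c *\<^sub>C frechet_derivative g (at x) h"
proof -
  obtain D where D: "(g has_derivative D) (at x)" "\<And>c h. D (c *\<^sub>C h) = c *\<^sub>C D h"
    using g x unfolding Hv_iff holomorphic_map_on_def by blast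
  then have "D = frechet_derivative g (at x)" by (rule_tac frechet_derivative_at)
  with D show "(g has_derivative frechet_derivative g (at x)) (at x)"
    "frechet_derivative g (at x) (c *\<^sub>C h) = c *\<^sub>C frechet_derivative g (at x) h" by auto
qed

text \<open>Cauchy's estimates on complex lines, uniform over the unit ball.\<close>

lemma Hv_local_estimate:
  assumes a: "a \<in> U"
  obtains \<rho> C where "0 < \<rho>" "0 \<le> C" "ball a \<rho> \<subseteq> U"
    "\<And>g h. g \<in> carrier H \<Longrightarrow> cmod (frechet_derivative g (at a) h) \<le> C * nrm H g * norm h"
    "\<And>g h. g \<in> carrier H \<Longrightarrow> norm h < \<rho> \<Longrightarrow>
      cmod (g (a + h) - g a - frechet_derivative g (at a) h) \<le> C * nrm H g * (norm h)\<^sup>2"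
proof -
  have "isCont v a"
    using weight open_U a unfolding weight_on_def by (simp add: continuous_on_eq_continuous_at)
  then have "\<forall>\<^sub>F x in at a. v x > v a / 2"
    using v_pos[OF a] by (intro order_tendstoD) (auto simp: isCont_def)
  then obtain d where "d > 0" "\<And>x. x \<noteq> a \<Longrightarrow> dist x a < d \<Longrightarrow> v x > v a / 2"
    by (auto simp: eventually_at)
  then have d: "d > 0" "\<And>x. dist x a < d \<Longrightarrow> v x > v a / 2"
    using v_pos[OF a] by (metis field_sum_of_halves less_add_same_cancel1 half_gt_zero)+
  obtain d' where d': "d' > 0" "ball a d' \<subseteq> U" using open_U a by (meson open_contains_ball)
  define R where "R = min d d'"
  \<comment> \<open>By continuity the weight stays above half its value at \<open>a\<close> on the
    ball of radius \<open>R\<close>, so each \<open>g\<close> in \<open>H\<close> is bounded there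
    by \<open>nrm H g / m\<close>.\<close>
  define m where "m = v a / 2"
  have R: "R > 0" "ball a R \<subseteq> U" and m: "m > 0" using d d' v_pos[OF a] by (auto simp: R_def m_def)
  have vm: "v x \<ge> m" if "x \<in> ball a R" for x
    using d(2)[of x] that by (auto simp: R_def m_def dist_commute)
  \<comment> \<open>The two Cauchy constants for a function bounded by \<open>1 / m\<close> on a
    disc of radius \<open>R\<close>, added so that one constant serves both estimates.\<close>
  define C where "C = 4 / (m * R) + 32 / (m * R\<^sup>2)"
  have C: "C \<ge> 4 / (m * R)" "C \<ge> 32 / (m * R\<^sup>2)" using R m by (auto simp: C_def)
  have C0: "C \<ge> 0" using R m by (simp add: C_def)
  have main: "cmod (frechet_derivative g (at a) h) \<le> C * nrm H g * norm h \<and>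
    (norm h < R / 2 \<longrightarrow>
      cmod (g (a + h) - g a - frechet_derivative g (at a) h) \<le> C * nrm H g * (norm h)\<^sup>2)"
    if g: "g \<in> carrier H" for g h
  proof (cases "h = 0")
    case True
    then show ?thesis
      using has_derivative_frechet(2)[OF g a, of 0 0] by (simp add: scaleC_complex_def)
  next
    case False
    \<comment> \<open>The one-variable estimates apply to the slice of \<open>g\<close> along the
      complex line through \<open>a\<close> in the unit direction \<open>e\<close>, taken at the
      parameter \<open>norm h\<close>. Their constants depend neither on \<open>e\<close> nor on
      \<open>g\<close>.\<close>
    define e where "e = complex_of_real (inverse (norm h)) *\<^sub>C h"
    have e: "norm e = 1" using False by (simp add: e_def norm_scaleC norm_inverse)
    have he: "h = complex_of_real (norm h) *\<^sub>C e"
      using False by (simp add: e_def scaleC_scaleC flip: of_real_mult)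
    define u where "u = (\<lambda>z. g (a + z *\<^sub>C e))"
    define N where "N = nrm H g"
    have N: "N \<ge> 0" using Hv_nrm_nonneg[OF g] by (simp add: N_def)
    have ball: "a + z *\<^sub>C e \<in> ball a R" if "z \<in> ball 0 R" for z
      using that by (simp add: dist_norm norm_scaleC e)
    have u': "(u has_field_derivative frechet_derivative g (at (a + z *\<^sub>C e)) e) (at z)"
      if z: "z \<in> ball 0 R" for z
    proof -
      have zU: "a + z *\<^sub>C e \<in> U" using ball[OF z] R by blast
      have "((\<lambda>z. a + z *\<^sub>C e) has_derivative (\<lambda>z. z *\<^sub>C e)) (at z)"
        using has_derivative_add[OF has_derivative_const[of a]
            bounded_linear.has_derivative[OF bounded_linear_scaleC_left has_derivative_ident]]
        by simp
      from has_derivative_compose[OF this has_derivative_frechet(1)[OF g zU]]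
      show ?thesis
        unfolding u_def has_field_derivative_def
        by (rule has_derivative_eq_rhs)
          (simp add: fun_eq_iff has_derivative_frechet(2)[OF g zU] scaleC_complex_def mult.commute)
    qed
    have hol: "u holomorphic_on ball 0 R"
      unfolding holomorphic_on_open[OF open_ball] using u' by blast
    have bound: "cmod (u z) \<le> N / m" if z: "z \<in> ball 0 R" for z
    proof -
      have "m * cmod (u z) \<le> v (a + z *\<^sub>C e) * cmod (u z)"
        using vm[OF ball[OF z]] by (intro mult_right_mono) auto
      also have "\<dots> \<le> N" unfolding u_def N_def by (rule Hv_bound[OF g]) (use ball[OF z] R in blast)
      finally show ?thesis using m by (simp add: field_simps)
    qed
    have du: "deriv u 0 = frechet_derivative g (at a) e"
      using DERIV_imp_deriv[OF u'[of 0]] R by simp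
    have fd: "frechet_derivative g (at a) h = of_real (norm h) * frechet_derivative g (at a) e"
      using has_derivative_frechet(2)[OF g a, of "of_real (norm h)" e] he
      by (simp add: scaleC_complex_def)
    have "cmod (deriv u 0) \<le> 4 * (N / m) / R"
      by (rule holomorphic_second_order(1)[OF hol R(1) bound])
    also have "\<dots> = 4 / (m * R) * N" by (simp add: field_simps)
    also have "\<dots> \<le> C * N" using C(1) N by (rule mult_right_mono)
    finally have "norm h * cmod (frechet_derivative g (at a) e) \<le> norm h * (C * N)"
      unfolding du by (rule mult_left_mono) simp
    then have 1: "cmod (frechet_derivative g (at a) h) \<le> C * N * norm h"
      by (simp add: fd norm_mult mult.commute mult.left_commute)
    have "cmod (g (a + h) - g a - frechet_derivative g (at a) h) \<le> C * N * (norm h)\<^sup>2"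
      if h: "norm h < R / 2"
    proof -
      have "cmod (u (of_real (norm h)) - u 0 - deriv u 0 * of_real (norm h))
          \<le> 32 * (N / m) / R\<^sup>2 * (cmod (of_real (norm h)))\<^sup>2"
        by (rule holomorphic_second_order(2)[OF hol R(1) bound]) (use h in simp_all)
      also have "\<dots> = 32 / (m * R\<^sup>2) * N * (norm h)\<^sup>2" by (simp add: field_simps)
      also have "\<dots> \<le> C * N * (norm h)\<^sup>2"
        using C(2) N by (intro mult_right_mono) auto
      also have "u (of_real (norm h)) = g (a + h)" using he by (simp add: u_def)
      also have "u 0 = g a" by (simp add: u_def)
      finally show ?thesis by (simp add: du fd mult.commute)
    qed
    with 1 show ?thesis by (simp add: N_def)
  qed
  show ?thesis
  proof (rule that[of "R / 2" C])
    show "ball a (R / 2) \<subseteq> U" using R by auto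
  qed (use R C0 main in auto)
qed

lemma unit_ball_equicontinuous:
  assumes a: "a \<in> U" and \<eta>: "0 < \<eta>"
  obtains \<delta> where "0 < \<delta>" "ball a \<delta> \<subseteq> U"
    "\<And>g b. g \<in> unit_ball H \<Longrightarrow> b \<in> ball a \<delta> \<Longrightarrow> cmod (g b - g a) < \<eta>"
proof -
  obtain \<rho> C where \<rho>: "0 < \<rho>" "0 \<le> C" "ball a \<rho> \<subseteq> U"
    and est: "\<And>g h. g \<in> carrier H \<Longrightarrow> cmod (frechet_derivative g (at a) h) \<le> C * nrm H g * norm h"
      "\<And>g h. g \<in> carrier H \<Longrightarrow> norm h < \<rho> \<Longrightarrow>
        cmod (g (a + h) - g a - frechet_derivative g (at a) h) \<le> C * nrm H g * (norm h)\<^sup>2"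
    using Hv_local_estimate[OF a] by blast
  \<comment> \<open>With \<open>norm h < 1\<close> the quadratic term is absorbed into the linear
    one, whence \<open>2 * C\<close>; the summand 1 keeps the denominator positive when
    \<open>C = 0\<close>.\<close>
  define \<delta> where "\<delta> = min (min \<rho> 1) (\<eta> / (2 * C + 1))"
  have "0 < \<delta>" using \<rho> \<eta> by (simp add: \<delta>_def)
  moreover have "ball a \<delta> \<subseteq> U" using \<rho> by (auto simp: \<delta>_def)
  moreover have "cmod (g b - g a) < \<eta>" if g: "g \<in> unit_ball H" and b: "b \<in> ball a \<delta>" for g b
  proof -
    define h where "h = b - a"
    have h: "norm h < \<rho>" "norm h < 1" "norm h < \<eta> / (2 * C + 1)"
      using b by (auto simp: h_def \<delta>_def dist_norm norm_minus_commute)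
    have gH: "g \<in> carrier H" and g1: "nrm H g \<le> 1" using g unfolding unit_ball_def by auto
    have Cg: "C * nrm H g \<le> C" using g1 \<rho>(2) by (simp add: mult_left_le)
    have "cmod (g b - g a)
        \<le> cmod (g (a + h) - g a - frechet_derivative g (at a) h) + cmod (frechet_derivative g (at a) h)"
      using norm_triangle_ineq[of "g (a + h) - g a - frechet_derivative g (at a) h"
          "frechet_derivative g (at a) h"] by (simp add: h_def)
    also have "\<dots> \<le> C * nrm H g * (norm h)\<^sup>2 + C * nrm H g * norm h"
      by (intro add_mono est gH h)
    also have "\<dots> \<le> C * norm h + C * norm h"
    proof -
      have "(norm h)\<^sup>2 \<le> norm h" using h(2) by (simp add: power2_eq_square mult_left_le)
      then have "C * nrm H g * (norm h)\<^sup>2 \<le> C * norm h"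
        using Cg \<rho>(2) by (intro mult_mono) auto
      moreover have "C * nrm H g * norm h \<le> C * norm h"
        using Cg by (intro mult_right_mono) auto
      ultimately show ?thesis by simp
    qed
    also have "\<dots> \<le> (2 * C + 1) * norm h" by (simp add: algebra_simps)
    also have "\<dots> < \<eta>" using h(3) \<rho>(2) by (simp add: field_simps)
    finally show ?thesis .
  qed
  ultimately show ?thesis using that by blast
qed

end

section \<open>The predual\<close>

lemma sum_fun_apply: "(\<Sum>i\<in>I. f i) x = (\<Sum>i\<in>I. f i x :: 'b::comm_monoid_add)"
  by (induction I rule: infinite_finite_induct) simp_all

section \<open>Point evaluations and neighbourhoods of 0 in the compact-open topology\<close>

lemma continuous_map_compact_open_eval:
  assumes "x \<in> U"
  shows "continuous_map (compact_open U) euclidean (\<lambda>f. f x)"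
  unfolding continuous_map
proof (intro conjI allI impI)
  show "(\<lambda>f. f x) ` topspace (compact_open U) \<subseteq> topspace euclidean" by simp
  fix V :: "'b set" assume "openin euclidean V"
  then have "{f. f ` {x} \<subseteq> V} \<in> {{f. f ` K \<subseteq> V} | K V. compact K \<and> K \<subseteq> U \<and> open V}"
    using assms by (intro CollectI exI[of _ "{x}"] exI[of _ V]) auto
  then have "openin (compact_open U) {f. f x \<in> V}"
    unfolding compact_open_def by (simp add: topology_generated_by_Basis)
  moreover from this have "{f \<in> topspace (compact_open U). f x \<in> V} = {f. f x \<in> V}"
    using openin_subset by blast
  ultimately show "openin (compact_open U) {f \<in> topspace (compact_open U). f x \<in> V}" by simp
qed

text \<open>Induction over the generation of open sets: a finite intersection takes the union of the
  compact sets and the smaller radius, and a union uses the member that contains 0.\<close>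

lemma compact_open_nhds_zero:
  fixes W :: "('a::topological_space \<Rightarrow> 'b::real_normed_vector) set"
  assumes "openin (compact_open U) W" "0 \<in> W"
  shows "\<exists>K r. compact K \<and> K \<subseteq> U \<and> 0 < r \<and> (\<forall>f. (\<forall>x\<in>K. norm (f x) < r) \<longrightarrow> f \<in> W)"
proof -
  have "generate_topology_on {{f. f ` K \<subseteq> V} | K V. compact K \<and> K \<subseteq> U \<and> open V} W"
    using assms(1) unfolding compact_open_def by (rule openin_topology_generated_by)
  then have "0 \<in> W \<longrightarrow>
      (\<exists>K r. compact K \<and> K \<subseteq> U \<and> 0 < r \<and> (\<forall>f. (\<forall>x\<in>K. norm (f x) < r) \<longrightarrow> f \<in> W))"
  proof (induction rule: generate_topology_on.induct)
    case Empty
    then show ?case by simp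
  next
    case (Int A B)
    show ?case
    proof
      assume "0 \<in> A \<inter> B"
      then have "0 \<in> A" "0 \<in> B" by blast+
      then obtain K r K' r' where "compact K" "K \<subseteq> U" "0 < r" "\<forall>f. (\<forall>x\<in>K. norm (f x) < r) \<longrightarrow> f \<in> A"
        "compact K'" "K' \<subseteq> U" "0 < r'" "\<forall>f. (\<forall>x\<in>K'. norm (f x) < r') \<longrightarrow> f \<in> B"
        using Int.IH by blast
      then show "\<exists>K r. compact K \<and> K \<subseteq> U \<and> 0 < r \<and> (\<forall>f. (\<forall>x\<in>K. norm (f x) < r) \<longrightarrow> f \<in> A \<inter> B)"
        by (intro exI[of _ "K \<union> K'"] exI[of _ "min r r'"]) auto
    qed
  next
    case (UN K)
    show ?case
    proof
      assume "0 \<in> \<Union> K"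
      then obtain A where "A \<in> K" "0 \<in> A" by blast
      then show "\<exists>Ka r. compact Ka \<and> Ka \<subseteq> U \<and> 0 < r \<and> (\<forall>f. (\<forall>x\<in>Ka. norm (f x) < r) \<longrightarrow> f \<in> \<Union> K)"
        using UN.IH by (meson UnionI)
    qed
  next
    case (Basis s)
    then obtain K V where s: "s = {f. f ` K \<subseteq> V}" "compact K" "K \<subseteq> U" "open V" by blast
    show ?case
    proof
      assume "0 \<in> s"
      show "\<exists>K r. compact K \<and> K \<subseteq> U \<and> 0 < r \<and> (\<forall>f. (\<forall>x\<in>K. norm (f x) < r) \<longrightarrow> f \<in> s)"
      proof (cases "K = {}")
        \<comment> \<open>For empty \<open>K\<close> the subbasic set is everything, although
          \<open>V\<close> need not contain 0.\<close>
        case True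
        then show ?thesis using s by (intro exI[of _ "{}"] exI[of _ 1]) auto
      next
        case False
        then have "0 \<in> V" using \<open>0 \<in> s\<close> s by auto
        then obtain r where "0 < r" "ball 0 r \<subseteq> V" using s(4) by (meson open_contains_ball)
        then show ?thesis using s by (intro exI[of _ K] exI[of _ r]) auto
      qed
    qed
  qed
  with assms(2) show ?thesis by simp
qed

section \<open>The predual as a space of functionals\<close>

context weighted_domain
begin

abbreviation "G \<equiv> Gv U v"

lemma G_iff:
  "\<phi> \<in> carrier G \<longleftrightarrow> \<phi> \<in> carrier (dual H) \<and>
     continuous_map (subtopology (compact_open U) (unit_ball H)) euclidean \<phi>"
  unfolding Gv_def by simp

lemma nrm_G: "nrm G = nrm (dual H)"
  unfolding Gv_def by simp

lemma G_dual: "\<phi> \<in> carrier G \<Longrightarrow> \<phi> \<in> carrier H.ops"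
  unfolding G_iff dual_H by simp

lemma seminormed_space_G: "seminormed_space G"
proof -
  interpret D: seminormed_space "dual H" unfolding dual_H by (rule H.seminormed_space_ops)
  show ?thesis
  proof
    show "0 \<in> carrier G"
      unfolding G_iff using D.zero_mem by (simp add: zero_fun_def)
    show "\<phi> + \<psi> \<in> carrier G" if "\<phi> \<in> carrier G" "\<psi> \<in> carrier G" for \<phi> \<psi>
    proof -
      have "continuous_map (subtopology (compact_open U) (unit_ball H)) euclidean (\<phi> + \<psi>)"
        unfolding plus_fun_def using that by (simp add: G_iff continuous_map_add)
      then show ?thesis using that D.add_mem unfolding G_iff by blast
    qed
    show "c *\<^sub>C \<phi> \<in> carrier G" if "\<phi> \<in> carrier G" for c \<phi>
    proof -
      have "continuous_map euclidean euclidean (\<lambda>z::complex. c * z)"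
        by (simp add: continuous_on_mult_left)
      then have "continuous_map (subtopology (compact_open U) (unit_ball H)) euclidean ((\<lambda>z. c * z) \<circ> \<phi>)"
        using that unfolding G_iff by (blast intro: continuous_map_compose)
      moreover have "(\<lambda>z. c * z) \<circ> \<phi> = c *\<^sub>C \<phi>" by (simp add: fun_eq_iff scaleC_complex_def)
      ultimately show ?thesis
        using that D.scaleC_mem unfolding G_iff by simp
    qed
    show "seminorm_on (carrier G) (nrm G)"
      using D.seminorm unfolding seminorm_on_def nrm_G by (simp add: G_iff)
  qed
qed

sublocale G: seminormed_space G
  by (rule seminormed_space_G)

lemma operator_space_G: "operator_space G (whole_space :: 'f::complex_normed_vector nvs)"
  by (rule operator_space_whole[OF G.seminormed_space_axioms])

lemma G_bound: "\<phi> \<in> carrier G \<Longrightarrow> g \<in> carrier H \<Longrightarrow> cmod (\<phi> g) \<le> nrm G \<phi> * nrm H g"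
  using H.nrm_ops_bound[OF G_dual] by (simp add: nrm_G dual_H)

lemma G_nrm_le:
  assumes "0 \<le> c" "\<And>g. g \<in> carrier H \<Longrightarrow> cmod (\<phi> g) \<le> c * nrm H g"
  shows "nrm G \<phi> \<le> c"
  using H.nrm_ops_le[of c \<phi>] assms by (simp add: nrm_G dual_H)

text \<open>Approximation uniform on the unit ball preserves continuity there. This later brings the
  derivatives of \<open>Delta\<close> into \<open>G\<close>, where they arise as limits of
  difference quotients.\<close>

lemma G_closed:
  assumes \<phi>: "\<phi> \<in> carrier (dual H)"
    and approx: "\<And>\<epsilon>. 0 < \<epsilon> \<Longrightarrow> \<exists>\<psi>\<in>carrier G. \<forall>g\<in>unit_ball H. cmod (\<phi> g - \<psi> g) < \<epsilon>"
  shows "\<phi> \<in> carrier G"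
proof -
  have "\<forall>n. \<exists>\<psi>\<in>carrier G. \<forall>g\<in>unit_ball H. cmod (\<phi> g - \<psi> g) < inverse (real (Suc n))"
    using approx by simp
  then obtain \<psi> where \<psi>: "\<And>n. \<psi> n \<in> carrier G"
    "\<And>n g. g \<in> unit_ball H \<Longrightarrow> cmod (\<phi> g - \<psi> n g) < inverse (real (Suc n))"
    by metis
  have "continuous_map (subtopology (compact_open U) (unit_ball H)) Met_TC.mtopology \<phi>"
  proof (rule Met_TC.continuous_map_uniform_limit[where F = sequentially and f = \<psi>])
    show "\<forall>\<^sub>F n in sequentially.
        continuous_map (subtopology (compact_open U) (unit_ball H)) Met_TC.mtopology (\<psi> n)"
      using \<psi>(1) unfolding G_iff by (simp add: mtopology_is_euclidean)
    fix \<epsilon> :: real assume "0 < \<epsilon>"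
    then have "\<forall>\<^sub>F n in sequentially. inverse (real (Suc n)) < \<epsilon>"
      using LIMSEQ_inverse_real_of_nat by (rule_tac order_tendstoD) auto
    then show "\<forall>\<^sub>F n in sequentially.
        \<forall>g\<in>topspace (subtopology (compact_open U) (unit_ball H)). \<phi> g \<in> UNIV \<and> dist (\<psi> n g) (\<phi> g) < \<epsilon>"
    proof eventually_elim
      case (elim n)
      then show ?case using \<psi>(2)[of _ n] by (force simp: dist_norm norm_minus_commute)
    qed
  qed simp
  then show ?thesis using \<phi> unfolding G_iff by (simp add: mtopology_is_euclidean)
qed

section \<open>Evaluations and the density of their span\<close>

lemma Delta_apply: "g \<in> carrier H \<Longrightarrow> Delta U v x g = g x"
  unfolding Delta_def by simp

text \<open>Elements of \<open>H\<close> vanish off \<open>U\<close> by convention. Consequently an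
  operator composed with \<open>Delta\<close> vanishes there as well, as membership in
  \<open>Hv U v\<close> demands.\<close>

lemma Delta_outside: "x \<notin> U \<Longrightarrow> Delta U v x = 0"
  unfolding Delta_def by (auto simp: fun_eq_iff Hv_outside)

lemma Delta_mem:
  assumes x: "x \<in> U" shows "Delta U v x \<in> carrier G"
proof -
  have bound: "nrm whole_space (Delta U v x g) \<le> inverse (v x) * nrm H g" if "g \<in> carrier H" for g
    using Hv_bound[OF that x] v_pos[OF x] by (simp add: Delta_apply that field_simps)
  have "Delta U v x \<in> carrier (dual H)"
    unfolding dual_H
    by (rule H.opsI[OF _ _ _ bound])
      (simp_all add: Delta_def H.X.add_mem H.X.scaleC_mem)
  moreover have "continuous_map (subtopology (compact_open U) (unit_ball H)) euclidean (Delta U v x)"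
    by (rule continuous_map_eq[OF continuous_map_from_subtopology[OF
            continuous_map_compact_open_eval[OF x]]])
      (auto simp: Delta_def unit_ball_def)
  ultimately show ?thesis unfolding G_iff by simp
qed

lemma Delta_nrm: "x \<in> U \<Longrightarrow> v x * nrm G (Delta U v x) \<le> 1"
proof -
  assume x: "x \<in> U"
  have "nrm G (Delta U v x) \<le> inverse (v x)"
    by (rule G_nrm_le)
      (use Hv_bound[OF _ x] v_pos[OF x] in \<open>simp_all add: Delta_apply field_simps less_imp_le\<close>)
  then show ?thesis using v_pos[OF x] by (simp add: field_simps)
qed

text \<open>On the equicontinuous unit ball the compact-open topology is that of pointwise convergence.\<close>

lemma G_small_on_finite:
  assumes \<phi>: "\<phi> \<in> carrier G" and \<epsilon>: "0 < \<epsilon>"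
  obtains S \<eta> where "finite S" "S \<subseteq> U" "0 < \<eta>"
    "\<And>g. g \<in> unit_ball H \<Longrightarrow> (\<And>x. x \<in> S \<Longrightarrow> cmod (g x) \<le> \<eta>) \<Longrightarrow> cmod (\<phi> g) < \<epsilon>"
proof -
  let ?T = "subtopology (compact_open U) (unit_ball H)"
  have "openin ?T {g \<in> topspace ?T. \<phi> g \<in> ball 0 \<epsilon>}"
    using \<phi> unfolding G_iff by (intro openin_continuous_map_preimage[of _ euclidean]) auto
  then obtain W where W: "openin (compact_open U) W"
    "{g \<in> topspace ?T. \<phi> g \<in> ball 0 \<epsilon>} = W \<inter> unit_ball H"
    unfolding openin_subtopology by blast
  have top: "topspace (compact_open U) = (UNIV :: ('e \<Rightarrow> complex) set)"
  proof -
    have "{f. f ` {} \<subseteq> UNIV} \<in> {{f. f ` K \<subseteq> V} | K (V :: complex set). compact K \<and> K \<subseteq> U \<and> open V}"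
      by (intro CollectI exI[of _ "{}"] exI[of _ UNIV]) auto
    from Union_upper[OF this] show ?thesis
      unfolding compact_open_def topology_generated_by_topspace by (simp add: top.extremum_unique)
  qed
  have "0 \<in> {g \<in> topspace ?T. \<phi> g \<in> ball 0 \<epsilon>}"
    using \<epsilon> H.X.zero_in_unit_ball H.ops_zero[OF G_dual[OF \<phi>]] by (simp add: top)
  then have "0 \<in> W" using W(2) by blast
  then obtain K r where K: "compact K" "K \<subseteq> U" "0 < r"
    and KW: "\<forall>f. (\<forall>x\<in>K. norm (f x) < r) \<longrightarrow> f \<in> W"
    using compact_open_nhds_zero[OF W(1)] by blast
  \<comment> \<open>Half of \<open>r\<close> is reserved for the variation of \<open>g\<close> near
    \<open>a\<close>, the other half for its size at \<open>a\<close>; a finite subcover of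
    \<open>K\<close> then leaves finitely many points to control.\<close>
  have "\<forall>a\<in>K. \<exists>\<delta>>0. \<forall>g\<in>unit_ball H. \<forall>b\<in>ball a \<delta>. cmod (g b - g a) < r / 2"
  proof
    fix a assume "a \<in> K"
    then obtain \<delta> where "0 < \<delta>"
      "\<And>g b. g \<in> unit_ball H \<Longrightarrow> b \<in> ball a \<delta> \<Longrightarrow> cmod (g b - g a) < r / 2"
      using unit_ball_equicontinuous[of a "r / 2"] K(2,3) by (metis half_gt_zero subsetD)
    then show "\<exists>\<delta>>0. \<forall>g\<in>unit_ball H. \<forall>b\<in>ball a \<delta>. cmod (g b - g a) < r / 2" by blast
  qed
  then obtain \<delta> where \<delta>: "\<And>a. a \<in> K \<Longrightarrow> 0 < \<delta> a"
    "\<And>a g b. a \<in> K \<Longrightarrow> g \<in> unit_ball H \<Longrightarrow> b \<in> ball a (\<delta> a) \<Longrightarrow> cmod (g b - g a) < r / 2"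
    by metis
  obtain S where S: "S \<subseteq> K" "finite S" "K \<subseteq> (\<Union>a\<in>S. ball a (\<delta> a))"
  proof (rule compactE_image[OF K(1), of K "\<lambda>a. ball a (\<delta> a)"])
    show "K \<subseteq> (\<Union>a\<in>K. ball a (\<delta> a))" using \<delta>(1) by auto
  qed auto
  show ?thesis
  proof (rule that[of S "r / 2"])
    fix g assume g: "g \<in> unit_ball H" and small: "\<And>x. x \<in> S \<Longrightarrow> cmod (g x) \<le> r / 2"
    have "g \<in> W"
    proof (rule KW[rule_format])
      fix x assume "x \<in> K"
      then obtain a where a: "a \<in> S" "x \<in> ball a (\<delta> a)" using S by blast
      have "cmod (g x) \<le> cmod (g a) + cmod (g x - g a)"
        using norm_triangle_ineq[of "g a" "g x - g a"] by simp
      also have "\<dots> < r / 2 + r / 2"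
        using small[OF a(1)] \<delta>(2)[OF subsetD[OF S(1) a(1)] g a(2)] by (rule add_le_less_mono)
      finally show "cmod (g x) < r" by simp
    qed
    then have "g \<in> {g \<in> topspace ?T. \<phi> g \<in> ball 0 \<epsilon>}" using W(2) g by blast
    then show "cmod (\<phi> g) < \<epsilon>" by simp
  qed (use S K in auto)
qed

text \<open>The bound makes \<open>\<psi>\<close> vanish on the kernel of evaluation at
  \<open>x\<close>, and subtracting a suitable multiple of a fixed \<open>g0\<close> moves any
  \<open>g\<close> into that kernel. If all of \<open>H\<close> vanishes at \<open>x\<close>, then
  \<open>\<psi>\<close> is 0 on \<open>H\<close>.\<close>

lemma functional_dominated_by_eval:
  assumes \<psi>: "complex_linear_on (carrier H) \<psi>"
    and le: "\<And>g. g \<in> carrier H \<Longrightarrow> cmod (\<psi> g) \<le> C * cmod (g x)"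
  shows "\<exists>c. \<forall>g\<in>carrier H. \<psi> g = c * g x"
proof (cases "\<exists>g\<in>carrier H. g x \<noteq> 0")
  case True
  then obtain g0 where g0: "g0 \<in> carrier H" "g0 x \<noteq> 0" by blast
  have "\<psi> g = (\<psi> g0 / g0 x) * g x" if g: "g \<in> carrier H" for g
  proof -
    define h where "h = g + (- g x / g0 x) *\<^sub>C g0"
    have h: "h \<in> carrier H" "h x = 0"
      using g g0 H.X.add_mem H.X.scaleC_mem by (simp_all add: h_def scaleC_complex_def)
    have "\<psi> h = \<psi> g + (- g x / g0 x) * \<psi> g0"
      using \<psi> g g0 H.X.scaleC_mem unfolding complex_linear_on_def h_def by simp
    moreover have "\<psi> h = 0" using le[OF h(1)] h(2) by simp
    ultimately show ?thesis by (simp add: field_simps)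
  qed
  then show ?thesis by blast
next
  case False
  have "\<psi> g = 0 * g x" if "g \<in> carrier H" for g
  proof -
    have "g x = 0" using False that by blast
    then show ?thesis using le[OF that] by simp
  qed
  then show ?thesis by blast
qed

theorem span_Delta_dense:
  assumes \<phi>: "\<phi> \<in> carrier G" and \<epsilon>: "0 < \<epsilon>"
  obtains S c where "finite S" "S \<subseteq> U" "nrm G (\<phi> - (\<Sum>x\<in>S. c x *\<^sub>C Delta U v x)) \<le> \<epsilon>"
proof -
  obtain S \<eta> where S: "finite S" "S \<subseteq> U" and \<eta>: "0 < \<eta>"
    and small: "\<And>g. g \<in> unit_ball H \<Longrightarrow> (\<And>x. x \<in> S \<Longrightarrow> cmod (g x) \<le> \<eta>) \<Longrightarrow> cmod (\<phi> g) < \<epsilon>"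
    using G_small_on_finite[OF \<phi> \<epsilon>] by blast
  have \<phi>_lin: "complex_linear_on (carrier H) \<phi>"
    using H.ops_add[OF G_dual[OF \<phi>]] H.ops_scaleC[OF G_dual[OF \<phi>]]
    unfolding complex_linear_on_def scaleC_complex_def by blast
  have dom: "cmod (\<phi> g) \<le> \<epsilon> * nrm H g + (\<Sum>x\<in>S. \<epsilon> / \<eta> * cmod (g x))" if g: "g \<in> carrier H" for g
  proof -
    \<comment> \<open>Dividing \<open>g\<close> by \<open>t\<close> achieves both conditions of
      \<open>small\<close>: the quotient lies in the unit ball and is at most \<open>\<eta>\<close>
      on \<open>S\<close>.\<close>
    define t where "t = nrm H g + (\<Sum>x\<in>S. cmod (g x) / \<eta>)"
    have n: "nrm H g \<ge> 0" by (rule Hv_nrm_nonneg[OF g])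
    have s: "(\<Sum>x\<in>S. cmod (g x) / \<eta>) \<ge> 0" using \<eta> by (intro sum_nonneg) auto
    have "cmod (\<phi> g) \<le> \<epsilon> * t"
    proof (cases "t = 0")
      case True
      then have "nrm H g = 0" using n s by (simp add: t_def)
      then show ?thesis using G_bound[OF \<phi> g] True by simp
    next
      case False
      then have t: "t > 0" using n s by (simp add: t_def)
      define g' where "g' = complex_of_real (inverse t) *\<^sub>C g"
      have "nrm H g' = nrm H g / t"
        using t g by (simp add: g'_def H.X.nrm_scaleC norm_inverse divide_inverse mult.commute)
      then have "nrm H g' \<le> 1" using t s by (simp add: t_def)
      then have g': "g' \<in> unit_ball H"
        unfolding unit_ball_def using g by (simp add: g'_def H.X.scaleC_mem)
      have "cmod (g' x) \<le> \<eta>" if "x \<in> S" for x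
      proof -
        have "cmod (g x) / \<eta> \<le> (\<Sum>x\<in>S. cmod (g x) / \<eta>)"
          using that S \<eta> by (intro member_le_sum) auto
        also have "\<dots> \<le> t" using n by (simp add: t_def)
        finally show ?thesis
          using t \<eta> by (simp add: g'_def scaleC_complex_def norm_mult norm_divide field_simps)
      qed
      then have "cmod (\<phi> g') < \<epsilon>" by (rule small[OF g'])
      moreover have "\<phi> g' = complex_of_real (inverse t) * \<phi> g"
        using \<phi>_lin g unfolding complex_linear_on_def g'_def by blast
      ultimately show ?thesis using t by (simp add: norm_mult norm_divide field_simps)
    qed
    also have "\<epsilon> * t = \<epsilon> * nrm H g + (\<Sum>x\<in>S. \<epsilon> / \<eta> * cmod (g x))"
      by (simp add: t_def distrib_left sum_distrib_left)
    finally show ?thesis .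
  qed
  have q: "seminorm_on (carrier H) (\<lambda>g. \<epsilon> * nrm H g)"
    using H.X.seminorm \<epsilon> unfolding seminorm_on_def
    by (auto simp: distrib_left[symmetric] intro!: mult_left_mono)
  have p: "seminorm_on (carrier H) (\<lambda>g. \<epsilon> / \<eta> * cmod (g x))" for x
    unfolding seminorm_on_def using \<epsilon> \<eta>
    by (auto simp: distrib_left[symmetric] scaleC_complex_def norm_mult
        intro!: divide_right_mono mult_left_mono norm_triangle_ineq simp flip: add_divide_distrib)
  obtain \<psi> where \<psi>: "\<forall>x\<in>S. complex_linear_on (carrier H) (\<psi> x) \<and>
      (\<forall>g\<in>carrier H. cmod (\<psi> x g) \<le> \<epsilon> / \<eta> * cmod (g x))"
    and \<psi>_le: "\<forall>g\<in>carrier H. cmod (\<phi> g - (\<Sum>x\<in>S. \<psi> x g)) \<le> \<epsilon> * nrm H g"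
    using H.X.seminorm_decomposition_sum[OF S(1) \<phi>_lin q p dom] by blast
  have "\<forall>x\<in>S. \<exists>c. \<forall>g\<in>carrier H. \<psi> x g = c * g x"
    using \<psi> functional_dominated_by_eval by blast
  then obtain c where c: "\<And>x g. x \<in> S \<Longrightarrow> g \<in> carrier H \<Longrightarrow> \<psi> x g = c x * g x" by metis
  have "nrm G (\<phi> - (\<Sum>x\<in>S. c x *\<^sub>C Delta U v x)) \<le> \<epsilon>"
  proof (rule G_nrm_le)
    fix g assume g: "g \<in> carrier H"
    have "(\<phi> - (\<Sum>x\<in>S. c x *\<^sub>C Delta U v x)) g = \<phi> g - (\<Sum>x\<in>S. \<psi> x g)"
      using c g by (simp add: sum_fun_apply scaleC_complex_def Delta_apply)
    then show "cmod ((\<phi> - (\<Sum>x\<in>S. c x *\<^sub>C Delta U v x)) g) \<le> \<epsilon> * nrm H g"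
      using \<psi>_le g by simp
  qed (use \<epsilon> in simp)
  with S that show ?thesis by blast
qed

end

section \<open>Linearization\<close>

context weighted_domain
begin

text \<open>The value of \<open>T\<^sub>f\<close> at \<open>\<phi>\<close> is the vector \<open>y\<close> with \<open>L y = \<phi> (L \<circ> f)\<close> for all functionals \<open>L\<close>.\<close>

definition weak_value :: "('e \<Rightarrow> 'f::complex_normed_vector) \<Rightarrow> (('e \<Rightarrow> complex) \<Rightarrow> complex) \<Rightarrow> 'f \<Rightarrow> bool"
  where "weak_value f \<phi> y \<longleftrightarrow>
    (\<forall>L. complex_linear_on UNIV L \<longrightarrow> (\<forall>x. cmod (L x) \<le> norm x) \<longrightarrow> L y = \<phi> (\<lambda>x. L (f x)))"

lemma functional_compose:
  fixes f :: "'e \<Rightarrow> 'f::complex_normed_vector"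
  assumes f: "f \<in> carrier (Hv U v)" and L: "complex_linear_on UNIV L" "\<forall>x. cmod (L x) \<le> norm x"
  shows "(\<lambda>x. L (f x)) \<in> carrier H" "nrm H (\<lambda>x. L (f x)) \<le> nrm (Hv U v) f"
  using Hv_compose_linear[OF f, of L 1] L unfolding complex_linear_on_def
  by (simp_all add: scaleC_complex_def)

text \<open>Testing with a norming functional \<open>L\<close> of \<open>y\<close> gives
  \<open>norm y\<close> as the modulus of \<open>\<phi>\<close> at \<open>L\<close> composed with
  \<open>f\<close>, and this composition has norm at most that of \<open>f\<close>.\<close>

lemma weak_value_norm:
  fixes f :: "'e \<Rightarrow> 'f::complex_normed_vector"
  assumes f: "f \<in> carrier (Hv U v)" and \<phi>: "\<phi> \<in> carrier G" and y: "weak_value f \<phi> y"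
  shows "norm y \<le> nrm (Hv U v) f * nrm G \<phi>"
proof -
  obtain L where L: "complex_linear_on UNIV L" "\<forall>x. cmod (L x) \<le> norm x" "L y = of_real (norm y)"
    using norming_functional[of y] by blast
  have "norm y = cmod (\<phi> (\<lambda>x. L (f x)))"
    using y L unfolding weak_value_def by (metis norm_of_real abs_norm_cancel)
  also have "\<dots> \<le> nrm G \<phi> * nrm H (\<lambda>x. L (f x))"
    by (rule G_bound[OF \<phi> functional_compose(1)[OF f L(1,2)]])
  also have "\<dots> \<le> nrm G \<phi> * nrm (Hv U v) f"
    by (intro mult_left_mono functional_compose(2)[OF f L(1,2)] G.nrm_nonneg \<phi>)
  finally show ?thesis by (simp add: mult.commute)
qed

lemma weak_value_add: "weak_value f \<phi> y \<Longrightarrow> weak_value f \<psi> z \<Longrightarrow> weak_value f (\<phi> + \<psi>) (y + z)"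
  unfolding weak_value_def complex_linear_on_def by auto

lemma weak_value_scaleC: "weak_value f \<phi> y \<Longrightarrow> weak_value f (c *\<^sub>C \<phi>) (c *\<^sub>C y)"
  unfolding weak_value_def complex_linear_on_def by (auto simp: scaleC_complex_def)

lemma weak_value_diff:
  assumes "weak_value f \<phi> y" "weak_value f \<psi> z" shows "weak_value f (\<phi> - \<psi>) (y - z)"
proof -
  have "weak_value f (\<phi> + (- 1) *\<^sub>C \<psi>) (y + (- 1) *\<^sub>C z)"
    by (intro weak_value_add weak_value_scaleC assms)
  then show ?thesis by (simp add: scaleC_minus_left)
qed

lemma weak_value_zero: "weak_value (f :: 'e \<Rightarrow> 'f::complex_normed_vector) 0 0"
  unfolding weak_value_def
proof (intro allI impI)
  fix L :: "'f \<Rightarrow> complex" assume "complex_linear_on UNIV L"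
  then have "L (0 *\<^sub>C 0) = 0 * L 0" unfolding complex_linear_on_def by blast
  then show "L 0 = 0 (\<lambda>x. L (f x))" by simp
qed

lemma weak_value_sum:
  assumes "\<And>i. i \<in> I \<Longrightarrow> weak_value f (\<phi> i) (y i)"
  shows "weak_value f (\<Sum>i\<in>I. \<phi> i) (\<Sum>i\<in>I. y i)"
  using assms
  by (induction I rule: infinite_finite_induct) (auto simp: weak_value_zero intro: weak_value_add)

lemma weak_value_Delta:
  assumes "f \<in> carrier (Hv U v)" shows "weak_value f (Delta U v x) (f x)"
  unfolding weak_value_def using functional_compose(1)[OF assms] by (simp add: Delta_apply)

text \<open>The difference of two weak values at \<open>\<phi>\<close> is a weak value at
  \<open>\<phi> - \<phi>\<close>, so the norm estimate makes it 0.\<close>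

lemma weak_value_unique:
  fixes f :: "'e \<Rightarrow> 'f::complex_normed_vector"
  assumes f: "f \<in> carrier (Hv U v)" and \<phi>: "\<phi> \<in> carrier G"
    and "weak_value f \<phi> y" "weak_value f \<phi> z"
  shows "y = z"
proof -
  have "norm (y - z) \<le> nrm (Hv U v) f * nrm G (\<phi> - \<phi>)"
    by (intro weak_value_norm f weak_value_diff assms G.diff_mem \<phi>)
  then show ?thesis using G.nrm_zero by simp
qed

lemma span_Delta_mem: "S \<subseteq> U \<Longrightarrow> (\<Sum>x\<in>S. c x *\<^sub>C Delta U v x) \<in> carrier G"
  by (intro G.sum_mem G.scaleC_mem Delta_mem) auto

text \<open>Combinations of evaluations have explicit weak values, the same combinations of values
  of \<open>f\<close>. Along combinations tending to \<open>\<phi>\<close> these form a Cauchy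
  sequence, and the defining identity passes to the limit because each test functional is
  bounded.\<close>

lemma weak_value_exists:
  fixes f :: "'e \<Rightarrow> 'f::cbanach"
  assumes f: "f \<in> carrier (Hv U v)" and \<phi>: "\<phi> \<in> carrier G"
  shows "\<exists>y. weak_value f \<phi> y"
proof -
  define N where "N = nrm (Hv U v) f"
  have N: "N \<ge> 0" unfolding N_def by (rule Hv_nrm_nonneg[OF f])
  have "\<exists>\<psi> y. \<psi> \<in> carrier G \<and> weak_value f \<psi> y \<and> nrm G (\<phi> - \<psi>) \<le> inverse (real (Suc n))" for n
  proof -
    obtain S c where S: "S \<subseteq> U" and le: "nrm G (\<phi> - (\<Sum>x\<in>S. c x *\<^sub>C Delta U v x)) \<le> inverse (real (Suc n))"
      using span_Delta_dense[OF \<phi>, of "inverse (real (Suc n))"]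
      by (metis inverse_positive_iff_positive of_nat_0_less_iff zero_less_Suc)
    have "weak_value f (\<Sum>x\<in>S. c x *\<^sub>C Delta U v x) (\<Sum>x\<in>S. c x *\<^sub>C f x)"
      by (intro weak_value_sum weak_value_scaleC weak_value_Delta f)
    then show ?thesis using le span_Delta_mem[OF S] by blast
  qed
  then obtain \<psi> y where \<psi>: "\<And>n. \<psi> n \<in> carrier G" "\<And>n. weak_value f (\<psi> n) (y n)"
    and close: "\<And>n. nrm G (\<phi> - \<psi> n) \<le> inverse (real (Suc n))" by metis
  have "Cauchy y"
  proof (rule metric_CauchyI)
    fix e :: real assume e: "0 < e"
    have "(\<lambda>n. N * (2 * inverse (real (Suc n)))) \<longlonglongrightarrow> N * (2 * 0)"
      by (intro tendsto_intros LIMSEQ_inverse_real_of_nat)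
    then obtain M where M: "\<And>n. n \<ge> M \<Longrightarrow> N * (2 * inverse (real (Suc n))) < e"
      using order_tendstoD(2)[of _ _ sequentially e] e by (fastforce simp: eventually_sequentially)
    have "dist (y m) (y n) < e" if "m \<ge> M" "n \<ge> M" for m n
    proof -
      \<comment> \<open>Both approximants are compared through \<open>\<phi>\<close>, which costs
        the factor 2.\<close>
      have "nrm G (\<psi> m - \<psi> n) = nrm G ((\<phi> - \<psi> n) - (\<phi> - \<psi> m))" by simp
      also have "\<dots> \<le> nrm G (\<phi> - \<psi> n) + nrm G (\<phi> - \<psi> m)"
        by (intro G.nrm_diff G.diff_mem \<phi> \<psi>)
      also have "\<dots> \<le> inverse (real (Suc M)) + inverse (real (Suc M))"
      proof (rule add_mono)
        show "nrm G (\<phi> - \<psi> n) \<le> inverse (real (Suc M))"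
          using that by (intro order_trans[OF close[of n]] le_imp_inverse_le) auto
        show "nrm G (\<phi> - \<psi> m) \<le> inverse (real (Suc M))"
          using that by (intro order_trans[OF close[of m]] le_imp_inverse_le) auto
      qed
      finally have *: "nrm G (\<psi> m - \<psi> n) \<le> 2 * inverse (real (Suc M))" by simp
      have "norm (y m - y n) \<le> N * nrm G (\<psi> m - \<psi> n)"
        unfolding N_def by (intro weak_value_norm f weak_value_diff \<psi> G.diff_mem)
      also have "\<dots> \<le> N * (2 * inverse (real (Suc M)))" using * N by (rule mult_left_mono)
      finally show ?thesis using M[of M] by (simp add: dist_norm)
    qed
    then show "\<exists>M. \<forall>m\<ge>M. \<forall>n\<ge>M. dist (y m) (y n) < e" by blast
  qed
  then obtain z where z: "y \<longlonglongrightarrow> z" using Cauchy_convergent convergent_def by blast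
  have "weak_value f \<phi> z"
    unfolding weak_value_def
  proof (intro allI impI)
    fix L :: "'f \<Rightarrow> complex" assume L: "complex_linear_on UNIV L" "\<forall>x. cmod (L x) \<le> norm x"
    have bl: "bounded_linear L"
      by (rule bounded_linear_of_complex_linear[where K = 1])
        (use L in \<open>auto simp: complex_linear_on_def scaleC_complex_def\<close>)
    have lim1: "(\<lambda>n. L (y n)) \<longlonglongrightarrow> L z" by (rule bounded_linear.tendsto[OF bl z])
    let ?g = "\<lambda>x. L (f x)"
    have g: "?g \<in> carrier H" by (rule functional_compose(1)[OF f L])
    have "(\<lambda>n. \<phi> ?g - L (y n)) \<longlonglongrightarrow> 0"
    proof (rule Lim_null_comparison[where g = "\<lambda>n. inverse (real (Suc n)) * nrm H ?g"])
      show "\<forall>\<^sub>F n in sequentially. norm (\<phi> ?g - L (y n)) \<le> inverse (real (Suc n)) * nrm H ?g"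
      proof (intro always_eventually allI)
        fix n
        have "L (y n) = \<psi> n ?g" using \<psi>(2)[of n] L unfolding weak_value_def by blast
        then have "norm (\<phi> ?g - L (y n)) \<le> nrm G (\<phi> - \<psi> n) * nrm H ?g"
          using G_bound[OF G.diff_mem[OF \<phi> \<psi>(1)] g, of n] by simp
        also have "\<dots> \<le> inverse (real (Suc n)) * nrm H ?g"
          by (intro mult_right_mono close Hv_nrm_nonneg g)
        finally show "norm (\<phi> ?g - L (y n)) \<le> inverse (real (Suc n)) * nrm H ?g" .
      qed
      show "(\<lambda>n. inverse (real (Suc n)) * nrm H ?g) \<longlonglongrightarrow> 0"
        by (intro tendsto_mult_left_zero LIMSEQ_inverse_real_of_nat)
    qed
    then have "(\<lambda>n. \<phi> ?g - (\<phi> ?g - L (y n))) \<longlonglongrightarrow> \<phi> ?g - 0"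
      by (intro tendsto_diff tendsto_const)
    then show "L z = \<phi> ?g" using lim1 LIMSEQ_unique by fastforce
  qed
  then show ?thesis ..
qed

text \<open>The difference of the two operators is bounded and kills the span of the evaluations,
  which is dense.\<close>

lemma linearization_unique:
  fixes T T' :: "(('e \<Rightarrow> complex) \<Rightarrow> complex) \<Rightarrow> 'f::complex_normed_vector"
  assumes T: "T \<in> carrier (bounded_ops G whole_space)" and T': "T' \<in> carrier (bounded_ops G whole_space)"
    and eq: "\<And>x. x \<in> U \<Longrightarrow> T (Delta U v x) = T' (Delta U v x)"
  shows "T = T'"
proof -
  interpret L: operator_space G "whole_space :: 'f nvs" by (rule operator_space_G)
  interpret S: seminormed_space L.ops by (rule L.seminormed_space_ops)
  have D: "T - T' \<in> carrier L.ops" using T T' by (rule S.diff_mem)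
  have "(T - T') \<phi> = 0" if \<phi>: "\<phi> \<in> carrier G" for \<phi>
  proof -
    have le: "norm ((T - T') \<phi>) \<le> nrm L.ops (T - T') * \<epsilon>" if \<epsilon>: "0 < \<epsilon>" for \<epsilon>
    proof -
      obtain S c where S: "S \<subseteq> U" and le: "nrm G (\<phi> - (\<Sum>x\<in>S. c x *\<^sub>C Delta U v x)) \<le> \<epsilon>"
        using span_Delta_dense[OF \<phi> \<epsilon>] by metis
      let ?\<psi> = "\<Sum>x\<in>S. c x *\<^sub>C Delta U v x"
      have \<psi>: "?\<psi> \<in> carrier G" by (rule span_Delta_mem[OF S])
      have "(T - T') ?\<psi> = (\<Sum>x\<in>S. (T - T') (c x *\<^sub>C Delta U v x))"
        by (rule L.ops_sum[OF D]) (use S in \<open>auto intro: G.scaleC_mem Delta_mem\<close>)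
      also have "\<dots> = 0"
      proof (rule sum.neutral, rule ballI)
        fix x assume "x \<in> S"
        then have x: "x \<in> U" using S by blast
        show "(T - T') (c x *\<^sub>C Delta U v x) = 0"
          using eq[OF x] by (simp only: L.ops_scaleC[OF D Delta_mem[OF x]]) simp
      qed
      finally have "(T - T') \<phi> = (T - T') (\<phi> - ?\<psi>)"
        using L.ops_diff[OF D \<phi> \<psi>] by simp
      then have "norm ((T - T') \<phi>) \<le> nrm L.ops (T - T') * nrm G (\<phi> - ?\<psi>)"
        using L.nrm_ops_bound[OF D G.diff_mem[OF \<phi> \<psi>]] by simp
      also have "\<dots> \<le> nrm L.ops (T - T') * \<epsilon>"
        using le L.nrm_ops_nonneg[OF D] by (rule mult_left_mono)
      finally show ?thesis .
    qed
    have "norm ((T - T') \<phi>) \<le> 0"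
    proof (rule field_le_epsilon)
      fix e :: real assume e: "0 < e"
      have K: "nrm L.ops (T - T') \<ge> 0" by (rule L.nrm_ops_nonneg[OF D])
      have "norm ((T - T') \<phi>) \<le> nrm L.ops (T - T') * (e / (nrm L.ops (T - T') + 1))"
        using K e by (intro le) (simp add: add_nonneg_pos)
      also have "\<dots> \<le> e" using K e by (simp add: field_simps)
      finally show "norm ((T - T') \<phi>) \<le> 0 + e" by simp
    qed
    then show ?thesis by simp
  qed
  then show ?thesis
    by (intro L.ops_eqI[OF T T']) simp
qed

lemma linearization_properties:
  fixes f :: "'e \<Rightarrow> 'f::cbanach"
  assumes f: "f \<in> carrier (Hv U v)"
  shows "linearization U v f \<in> carrier (bounded_ops G whole_space)" (is ?mem)
    and "\<And>x. linearization U v f (Delta U v x) = f x"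
    and "nrm (bounded_ops G whole_space) (linearization U v f) \<le> nrm (Hv U v) f"
proof -
  interpret L: operator_space G "whole_space :: 'f nvs" by (rule operator_space_G)
  have N: "nrm (Hv U v) f \<ge> 0" by (rule Hv_nrm_nonneg[OF f])
  obtain y where y: "\<And>\<phi>. \<phi> \<in> carrier G \<Longrightarrow> weak_value f \<phi> (y \<phi>)"
    using weak_value_exists[OF f] by metis
  define T where "T = (\<lambda>\<phi>. if \<phi> \<in> carrier G then y \<phi> else 0)"
  \<comment> \<open>By uniqueness, exhibiting any weak value computes \<open>T\<close>. Linearity
    and the values at evaluations thus reduce to the closure rules for
    \<open>weak_value\<close>.\<close>
  have T: "T \<phi> = z" if "\<phi> \<in> carrier G" "weak_value f \<phi> z" for \<phi> z
    using weak_value_unique[OF f that(1) y[OF that(1)] that(2)] that(1) by (simp add: T_def)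
  have bound: "nrm whole_space (T \<phi>) \<le> nrm (Hv U v) f * nrm G \<phi>" if "\<phi> \<in> carrier G" for \<phi>
    using weak_value_norm[OF f that y[OF that]] that by (simp add: T_def)
  have wT: "weak_value f \<phi> (T \<phi>)" if "\<phi> \<in> carrier G" for \<phi>
    using y[OF that] that by (simp add: T_def)
  have T_ops: "T \<in> carrier L.ops"
  proof (rule L.opsI[OF _ _ _ bound])
    show "T (\<phi> + \<psi>) = T \<phi> + T \<psi>" if "\<phi> \<in> carrier G" "\<psi> \<in> carrier G" for \<phi> \<psi>
      by (intro T G.add_mem weak_value_add wT that)
    show "T (c *\<^sub>C \<phi>) = c *\<^sub>C T \<phi>" if "\<phi> \<in> carrier G" for c \<phi>
      by (intro T G.scaleC_mem weak_value_scaleC wT that)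
  qed (simp_all add: T_def)
  have T_Delta: "T (Delta U v x) = f x" if "x \<in> U" for x
    by (intro T Delta_mem weak_value_Delta f that)
  have lin: "linearization U v f = T"
    unfolding linearization_def
  proof (rule the_equality)
    show "T \<in> carrier L.ops \<and> (\<forall>x\<in>U. T (Delta U v x) = f x)" using T_ops T_Delta by blast
    show "T' = T" if "T' \<in> carrier L.ops \<and> (\<forall>x\<in>U. T' (Delta U v x) = f x)" for T'
      by (rule linearization_unique) (use that T_ops T_Delta in auto)
  qed
  show ?mem using T_ops lin by simp
  show "linearization U v f (Delta U v x) = f x" for x
    using T_Delta L.ops_zero[OF T_ops] Hv_outside[OF f] Delta_outside lin by (cases "x \<in> U") auto
  show "nrm L.ops (linearization U v f) \<le> nrm (Hv U v) f"
    unfolding lin by (rule L.nrm_ops_le[OF N bound])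
qed

section \<open>Holomorphy of \<open>Delta\<close>, with \<open>diff_functional a h\<close> as its
  derivative at \<open>a\<close> in the direction \<open>h\<close>\<close>

definition diff_functional :: "'e \<Rightarrow> 'e \<Rightarrow> ('e \<Rightarrow> complex) \<Rightarrow> complex" where
  "diff_functional a h = (\<lambda>g. if g \<in> carrier H then frechet_derivative g (at a) h else 0)"

lemma frechet_derivative_add:
  assumes "g \<in> carrier H" "k \<in> carrier H" "a \<in> U"
  shows "frechet_derivative (g + k) (at a) h = frechet_derivative g (at a) h + frechet_derivative k (at a) h"
proof -
  have "(g + k has_derivative (\<lambda>h. frechet_derivative g (at a) h + frechet_derivative k (at a) h)) (at a)"
    unfolding plus_fun_def by (intro has_derivative_add has_derivative_frechet assms)
  from frechet_derivative_at[OF this] show ?thesis by metis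
qed

lemma frechet_derivative_scaleC:
  assumes "g \<in> carrier H" "a \<in> U"
  shows "frechet_derivative (c *\<^sub>C g) (at a) h = c * frechet_derivative g (at a) h"
proof -
  have "(c *\<^sub>C g has_derivative (\<lambda>h. c * frechet_derivative g (at a) h)) (at a)"
    unfolding scaleC_fun_def scaleC_complex_def
    by (intro has_derivative_mult_right has_derivative_frechet assms)
  from frechet_derivative_at[OF this] show ?thesis by metis
qed

text \<open>Membership in \<open>G\<close> holds because the functional is a norm limit of difference quotients of \<open>\<Delta>\<close>.\<close>

lemma diff_functional_mem:
  assumes a: "a \<in> U" shows "diff_functional a h \<in> carrier G"
proof -
  obtain \<rho> C where \<rho>: "0 < \<rho>" "0 \<le> C" "ball a \<rho> \<subseteq> U"
    and est: "\<And>g h. g \<in> carrier H \<Longrightarrow> cmod (frechet_derivative g (at a) h) \<le> C * nrm H g * norm h"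
      "\<And>g h. g \<in> carrier H \<Longrightarrow> norm h < \<rho> \<Longrightarrow>
        cmod (g (a + h) - g a - frechet_derivative g (at a) h) \<le> C * nrm H g * (norm h)\<^sup>2"
    using Hv_local_estimate[OF a] by blast
  have bound: "nrm whole_space (diff_functional a h g) \<le> (C * norm h) * nrm H g"
    if "g \<in> carrier H" for g
    using est(1)[OF that, of h] that by (simp add: diff_functional_def mult_ac)
  show ?thesis
  proof (rule G_closed)
    show "diff_functional a h \<in> carrier (dual H)"
      unfolding dual_H
      by (rule H.opsI[OF _ _ _ bound])
        (simp_all add: diff_functional_def H.X.add_mem H.X.scaleC_mem a
          frechet_derivative_add frechet_derivative_scaleC scaleC_complex_def)
    fix \<epsilon> :: real assume \<epsilon>: "0 < \<epsilon>"
    \<comment> \<open>The first bound keeps a + t h inside the ball of radius \<open>\<rho>\<close>,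
      the second brings the error below \<open>\<epsilon>\<close>. The summands 1 avoid division by
      0, and halving \<open>s\<close> makes both inequalities strict.\<close>
    define s where "s = min (\<rho> / (norm h + 1)) (\<epsilon> / (C * (norm h)\<^sup>2 + 1))"
    define t where "t = s / 2"
    have pos: "norm h + 1 > 0" "C * (norm h)\<^sup>2 + 1 > 0"
      using \<rho>(2) by (simp_all add: add_nonneg_pos)
    have s: "s > 0" using \<rho>(1) \<epsilon> pos by (simp add: s_def)
    then have t: "t > 0" "t < s" by (simp_all add: t_def)
    have "t < \<rho> / (norm h + 1)" "t < \<epsilon> / (C * (norm h)\<^sup>2 + 1)"
      using t(2) by (simp_all add: s_def)
    then have "t * norm h + t < \<rho>" and t2: "t * (C * (norm h)\<^sup>2) + t < \<epsilon>"
      using pos by (simp_all add: pos_less_divide_eq distrib_left)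
    then have th: "norm (complex_of_real t *\<^sub>C h) < \<rho>" using t by (simp add: norm_scaleC)
    then have mem: "a + complex_of_real t *\<^sub>C h \<in> U"
      using \<rho>(3) by (auto simp: dist_norm subset_eq)
    let ?\<psi> = "complex_of_real (inverse t) *\<^sub>C (Delta U v (a + complex_of_real t *\<^sub>C h) - Delta U v a)"
    show "\<exists>\<psi>\<in>carrier G. \<forall>g\<in>unit_ball H. cmod (diff_functional a h g - \<psi> g) < \<epsilon>"
    proof (intro bexI ballI)
      show "?\<psi> \<in> carrier G" by (intro G.scaleC_mem G.diff_mem Delta_mem mem a)
      fix g assume "g \<in> unit_ball H"
      then have g: "g \<in> carrier H" "nrm H g \<le> 1" unfolding unit_ball_def by auto
      \<comment> \<open>After multiplication by \<open>t\<close> the error is a first-order Taylor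
        remainder, quadratic in \<open>t\<close>; cancelling \<open>t\<close> leaves one small
        factor.\<close>
      have "t * cmod (diff_functional a h g - ?\<psi> g)
          = cmod (of_real t * (diff_functional a h g - ?\<psi> g))" using t by (simp add: norm_mult)
      also have "of_real t * (diff_functional a h g - ?\<psi> g)
          = - (g (a + complex_of_real t *\<^sub>C h) - g a - frechet_derivative g (at a) (complex_of_real t *\<^sub>C h))"
        using t g by (simp add: diff_functional_def Delta_apply scaleC_complex_def field_simps
            has_derivative_frechet(2)[OF g(1) a])
      also have "cmod \<dots> \<le> C * nrm H g * (norm (complex_of_real t *\<^sub>C h))\<^sup>2"
        unfolding norm_minus_cancel by (rule est(2)[OF g(1) th])
      also have "\<dots> \<le> C * 1 * (norm (complex_of_real t *\<^sub>C h))\<^sup>2"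
        using \<rho>(2) g(2) by (intro mult_right_mono mult_left_mono) auto
      also have "\<dots> = t * (t * (C * (norm h)\<^sup>2))" by (simp add: norm_scaleC power2_eq_square)
      finally have "cmod (diff_functional a h g - ?\<psi> g) \<le> t * (C * (norm h)\<^sup>2)"
        using t by simp
      then show "cmod (diff_functional a h g - ?\<psi> g) < \<epsilon>" using t2 t by simp
    qed
  qed
qed

text \<open>The first-order remainder of \<open>Delta\<close> at \<open>a\<close> has norm at most
  \<open>C * (norm h)\<^sup>2\<close> in \<open>G\<close>, since the local estimate is uniform in
  \<open>g\<close>. A bounded \<open>T\<close> carries this over, so the derivative of the
  composition is \<open>T\<close> applied to \<open>diff_functional a h\<close>.\<close>

lemma compose_Delta_mem:
  fixes T :: "(('e \<Rightarrow> complex) \<Rightarrow> complex) \<Rightarrow> 'f::complex_normed_vector"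
  assumes T: "T \<in> carrier (bounded_ops G whole_space)"
  shows "(\<lambda>x. T (Delta U v x)) \<in> carrier (Hv U v)"
    and "nrm (Hv U v) (\<lambda>x. T (Delta U v x)) \<le> nrm (bounded_ops G whole_space) T"
proof -
  interpret L: operator_space G "whole_space :: 'f nvs" by (rule operator_space_G)
  define N where "N = nrm L.ops T"
  have N: "N \<ge> 0" unfolding N_def by (rule L.nrm_ops_nonneg[OF T])
  have T_bound: "norm (T \<phi>) \<le> N * nrm G \<phi>" if "\<phi> \<in> carrier G" for \<phi>
    using L.nrm_ops_bound[OF T that] by (simp add: N_def)
  have bound: "v x * norm (T (Delta U v x)) \<le> N" if x: "x \<in> U" for x
  proof -
    have "v x * norm (T (Delta U v x)) \<le> v x * (N * nrm G (Delta U v x))"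
      using v_pos[OF x] T_bound[OF Delta_mem[OF x]] by (intro mult_left_mono) auto
    also have "\<dots> = N * (v x * nrm G (Delta U v x))" by simp
    also have "\<dots> \<le> N" using Delta_nrm[OF x] N by (rule mult_left_le)
    finally show ?thesis .
  qed
  have "holomorphic_map_on (\<lambda>x. T (Delta U v x)) U"
    unfolding holomorphic_map_on_def
  proof
    fix a assume a: "a \<in> U"
    obtain \<rho> C where \<rho>: "0 < \<rho>" "0 \<le> C" "ball a \<rho> \<subseteq> U"
      and est: "\<And>g h. g \<in> carrier H \<Longrightarrow> cmod (frechet_derivative g (at a) h) \<le> C * nrm H g * norm h"
        "\<And>g h. g \<in> carrier H \<Longrightarrow> norm h < \<rho> \<Longrightarrow>
          cmod (g (a + h) - g a - frechet_derivative g (at a) h) \<le> C * nrm H g * (norm h)\<^sup>2"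
      using Hv_local_estimate[OF a] by blast
    define D where "D h = T (diff_functional a h)" for h
    have D_add: "D (h + k) = D h + D k" for h k
    proof -
      have "diff_functional a (h + k) = diff_functional a h + diff_functional a k"
        using linear_add[OF bounded_linear.linear[OF has_derivative_bounded_linear[OF
              has_derivative_frechet(1)[OF _ a]]]]
        by (auto simp: diff_functional_def fun_eq_iff)
      then show ?thesis
        unfolding D_def using L.ops_add[OF T diff_functional_mem[OF a] diff_functional_mem[OF a]] by simp
    qed
    have D_scale: "D (c *\<^sub>C h) = c *\<^sub>C D h" for c h
    proof -
      have "diff_functional a (c *\<^sub>C h) = c *\<^sub>C diff_functional a h"
        by (auto simp: diff_functional_def fun_eq_iff has_derivative_frechet(2)[OF _ a])
      then show ?thesis
        unfolding D_def using L.ops_scaleC[OF T diff_functional_mem[OF a]] by simp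
    qed
    have D_bound: "norm (D h) \<le> (N * C) * norm h" for h
    proof -
      have "nrm G (diff_functional a h) \<le> C * norm h"
        by (rule G_nrm_le) (use est(1)[of _ h] \<rho>(2) in \<open>auto simp: diff_functional_def mult_ac\<close>)
      then have "N * nrm G (diff_functional a h) \<le> N * (C * norm h)" using N by (rule mult_left_mono)
      then show ?thesis unfolding D_def using T_bound[OF diff_functional_mem[OF a, of h]] by simp
    qed
    have "((\<lambda>x. T (Delta U v x)) has_derivative D) (at a)"
      unfolding has_derivative_at_alt
    proof (intro conjI allI impI)
      show "bounded_linear D" by (rule bounded_linear_of_complex_linear[OF D_add D_scale D_bound])
      fix e :: real assume e: "0 < e"
      define \<delta> where "\<delta> = min \<rho> (e / (N * C + 1))"
      have NC: "N * C + 1 > 0" using N \<rho>(2) by (simp add: add_nonneg_pos)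
      have "norm (T (Delta U v y) - T (Delta U v a) - D (y - a)) \<le> e * norm (y - a)"
        if y: "norm (y - a) < \<delta>" for y
      proof -
        define h where "h = y - a"
        have h: "norm h < \<rho>" "norm h < e / (N * C + 1)" using y by (simp_all add: h_def \<delta>_def)
        have yU: "y \<in> U" using h \<rho>(3) by (auto simp: h_def dist_norm subset_eq norm_minus_commute)
        let ?\<phi> = "Delta U v y - Delta U v a - diff_functional a h"
        have \<phi>: "?\<phi> \<in> carrier G" by (intro G.diff_mem Delta_mem diff_functional_mem yU a)
        have "nrm G ?\<phi> \<le> C * (norm h)\<^sup>2"
        proof (rule G_nrm_le)
          fix g assume g: "g \<in> carrier H"
          show "cmod (?\<phi> g) \<le> C * (norm h)\<^sup>2 * nrm H g"
            using est(2)[OF g h(1)] g by (simp add: Delta_apply diff_functional_def h_def mult_ac)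
        qed (use \<rho>(2) in simp)
        then have "norm (T ?\<phi>) \<le> N * (C * (norm h)\<^sup>2)"
          using T_bound[OF \<phi>] N by (meson mult_left_mono order_trans)
        also have "\<dots> = (N * C * norm h) * norm h" by (simp add: power2_eq_square)
        also have "\<dots> \<le> e * norm h"
        proof (rule mult_right_mono)
          have "N * C * norm h \<le> (N * C + 1) * norm h" by (simp add: distrib_right)
          also have "\<dots> \<le> e" using h(2) NC by (simp add: pos_less_divide_eq mult.commute less_imp_le)
          finally show "N * C * norm h \<le> e" .
        qed simp
        also have "T ?\<phi> = T (Delta U v y) - T (Delta U v a) - D h"
          unfolding D_def
          by (simp only: L.ops_diff[OF T] G.diff_mem Delta_mem diff_functional_mem yU a)
        finally show ?thesis by (simp add: h_def)
      qed
      moreover have "\<delta> > 0" using \<rho>(1) e NC by (simp add: \<delta>_def)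
      ultimately show "\<exists>d>0. \<forall>y. norm (y - a) < d \<longrightarrow>
          norm (T (Delta U v y) - T (Delta U v a) - D (y - a)) \<le> e * norm (y - a)" by blast
    qed
    with D_scale show "\<exists>D. ((\<lambda>x. T (Delta U v x)) has_derivative D) (at a) \<and>
        (\<forall>c h. D (c *\<^sub>C h) = c *\<^sub>C D h)" by blast
  qed
  moreover have "T (Delta U v x) = 0" if "x \<notin> U" for x
    unfolding Delta_outside[OF that] by (rule L.ops_zero[OF T])
  ultimately show "(\<lambda>x. T (Delta U v x)) \<in> carrier (Hv U v)"
    using bound by (intro HvI)
  show "nrm (Hv U v) (\<lambda>x. T (Delta U v x)) \<le> nrm L.ops T"
    using Hv_nrm_le[OF N bound] by (simp add: N_def)
qed

lemma linearization_eqI: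
  fixes f :: "'e \<Rightarrow> 'f::cbanach"
  assumes "f \<in> carrier (Hv U v)" "T \<in> carrier (bounded_ops G whole_space)"
    and "\<And>x. x \<in> U \<Longrightarrow> T (Delta U v x) = f x"
  shows "linearization U v f = T"
  by (rule linearization_unique)
    (use assms linearization_properties(1,2)[OF assms(1)] in auto)

text \<open>Composition with \<open>Delta\<close> inverts the linearization. Neither map increases
  norms, so both preserve them.\<close>

theorem linearization_isometric_isomorphism:
  "isometric_isomorphism (Hv U v :: ('e \<Rightarrow> 'f::cbanach) nvs) (bounded_ops G whole_space) (linearization U v)"
  unfolding isometric_isomorphism_def
proof (intro conjI ballI)
  let ?H = "Hv U v :: ('e \<Rightarrow> 'f) nvs"
  interpret F: seminormed_space ?H by (rule seminormed_space_Hv)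
  interpret L: operator_space G "whole_space :: 'f nvs" by (rule operator_space_G)
  interpret S: seminormed_space L.ops by (rule L.seminormed_space_ops)
  note lin = linearization_properties
  show "linear_between ?H L.ops (linearization U v)"
    unfolding linear_between_def
    by (auto intro!: linearization_eqI simp: lin F.add_mem F.scaleC_mem S.add_mem S.scaleC_mem)
  show "bij_betw (linearization U v) (carrier ?H) (carrier L.ops)"
  proof (rule bij_betwI[where g = "\<lambda>T x. T (Delta U v x)"])
    show "linearization U v (\<lambda>x. T (Delta U v x)) = T" if "T \<in> carrier L.ops" for T
      using that by (auto intro!: linearization_eqI compose_Delta_mem)
  qed (auto simp: lin compose_Delta_mem)
  show "nrm L.ops (linearization U v f) = nrm ?H f" if f: "f \<in> carrier ?H" for f
    using lin(3)[OF f] compose_Delta_mem(2)[OF lin(1)[OF f]] by (simp add: lin(2)[OF f])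
qed

end

section \<open>Transport of right \<open>p\<close>-nuclear representations\<close>

lemma (in seminormed_space) linear_between_diff:
  assumes "linear_between X Y T" "x \<in> carrier X" "y \<in> carrier X"
  shows "T (x - y) = T x - T y"
proof -
  have "T (x + (- 1) *\<^sub>C y) = T x + (- 1) *\<^sub>C T y"
    using assms scaleC_mem unfolding linear_between_def by metis
  then show ?thesis by (simp add: scaleC_minus_left)
qed

lemma (in seminormed_space) linear_between_sum:
  assumes "linear_between X Y T" "\<And>i. i \<in> I \<Longrightarrow> f i \<in> carrier X"
  shows "T (sum f I) = (\<Sum>i\<in>I. T (f i))"
proof -
  have "T (0 *\<^sub>C 0) = 0 *\<^sub>C T 0"
    using assms(1) zero_mem unfolding linear_between_def by blast
  then have "T 0 = 0" by simp
  moreover have "T (x + y) = T x + T y" if "x \<in> carrier X" "y \<in> carrier X" for x y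
    using assms(1) that unfolding linear_between_def by blast
  ultimately show ?thesis
    using assms(2) by (induction I rule: infinite_finite_induct) (auto simp: sum_mem)
qed

lemma isometric_isomorphism_inv:
  assumes X: "seminormed_space X" and J: "isometric_isomorphism X Y J"
  shows "isometric_isomorphism Y X (inv_into (carrier X) J)"
proof -
  interpret seminormed_space X by (rule X)
  let ?K = "inv_into (carrier X) J"
  have bij: "bij_betw J (carrier X) (carrier Y)" and lin: "linear_between X Y J"
    and iso: "\<And>x. x \<in> carrier X \<Longrightarrow> nrm Y (J x) = nrm X x"
    using J unfolding isometric_isomorphism_def by auto
  have K: "?K y \<in> carrier X" "J (?K y) = y" if "y \<in> carrier Y" for y
    using bij that by (auto simp: bij_betw_def inv_into_into f_inv_into_f)
  have eqI: "?K y = x" if "x \<in> carrier X" "J x = y" for x y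
    using bij that by (auto simp: bij_betw_def)
  have "linear_between Y X ?K"
    unfolding linear_between_def
  proof (intro conjI ballI allI)
    fix y z assume yz: "y \<in> carrier Y" "z \<in> carrier Y"
    show "?K (y + z) = ?K y + ?K z"
      using lin K[OF yz(1)] K[OF yz(2)] unfolding linear_between_def by (intro eqI add_mem) auto
  next
    fix c y assume y: "y \<in> carrier Y"
    show "?K (c *\<^sub>C y) = c *\<^sub>C ?K y"
      using lin K[OF y] unfolding linear_between_def by (intro eqI scaleC_mem) auto
  qed (use K in auto)
  moreover have "nrm X (?K y) = nrm Y y" if "y \<in> carrier Y" for y
    using iso[OF K(1)[OF that]] K(2)[OF that] by simp
  ultimately show ?thesis
    using bij unfolding isometric_isomorphism_def by (auto intro: bij_betw_inv_into)
qed

text \<open>For a sequence in the carrier, membership in \<open>ell_weak\<close> and the weak norm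
  depend only on this set of scalar sequences. Comparing such sets treats all exponents at once,
  infinity included.\<close>

definition weak_values :: "'a::complex_vector nvs \<Rightarrow> (nat \<Rightarrow> 'a) \<Rightarrow> (nat \<Rightarrow> complex) set" where
  "weak_values X x = (\<lambda>\<phi> n. \<phi> (x n)) ` unit_ball (dual X)"

lemma ell_weak_iff:
  "x \<in> carrier (ell_weak q X) \<longleftrightarrow> range x \<subseteq> carrier X \<and>
     weak_values X x \<subseteq> carrier (ell q whole_space) \<and>
     bdd_above (nrm (ell q whole_space) ` weak_values X x)"
  unfolding ell_weak_def weak_values_def by (auto simp: image_image)

lemma nrm_ell_weak: "nrm (ell_weak q X) x = Sup (nrm (ell q whole_space) ` weak_values X x)"
  unfolding ell_weak_def weak_values_def by (simp add: image_image)

text \<open>A functional in the dual ball of \<open>Y\<close> pulls back along \<open>J\<close> to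
  one in the dual ball of \<open>X\<close> with the same values on the sequence. The reverse
  inclusion will come from the inverse isometry.\<close>

lemma weak_values_isometry_subset:
  assumes X: "seminormed_space X" and Y: "seminormed_space Y"
    and J: "linear_between X Y J" "\<And>x. x \<in> carrier X \<Longrightarrow> nrm Y (J x) = nrm X x"
    and x: "range x \<subseteq> carrier X"
  shows "weak_values Y (\<lambda>n. J (x n)) \<subseteq> weak_values X x"
proof
  interpret X: operator_space X "whole_space :: complex nvs" by (rule operator_space_whole[OF X])
  interpret Y: operator_space Y "whole_space :: complex nvs" by (rule operator_space_whole[OF Y])
  have J_mem: "\<And>x. x \<in> carrier X \<Longrightarrow> J x \<in> carrier Y"
    using J(1) unfolding linear_between_def by blast
  fix s assume "s \<in> weak_values Y (\<lambda>n. J (x n))"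
  then obtain \<psi> where \<psi>: "\<psi> \<in> carrier Y.ops" "nrm Y.ops \<psi> \<le> 1" and s: "s = (\<lambda>n. \<psi> (J (x n)))"
    unfolding weak_values_def unit_ball_def dual_def by auto
  define \<phi> where "\<phi> = (\<lambda>z. if z \<in> carrier X then \<psi> (J z) else 0)"
  have bound: "nrm whole_space (\<phi> z) \<le> 1 * nrm X z" if z: "z \<in> carrier X" for z
  proof -
    have "norm (\<psi> (J z)) \<le> nrm Y.ops \<psi> * nrm Y (J z)"
      using Y.nrm_ops_bound[OF \<psi>(1) J_mem[OF z]] by simp
    also have "\<dots> \<le> 1 * nrm X z"
      unfolding J(2)[OF z] using \<psi>(2) X.X.nrm_nonneg[OF z] by (rule mult_right_mono)
    finally show ?thesis using z by (simp add: \<phi>_def)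
  qed
  have "\<phi> \<in> carrier X.ops"
    by (rule X.opsI[OF _ _ _ bound])
      (use J(1) in \<open>auto simp: \<phi>_def linear_between_def X.X.add_mem X.X.scaleC_mem
        Y.ops_add[OF \<psi>(1)] Y.ops_scaleC[OF \<psi>(1)]\<close>)
  moreover have "nrm X.ops \<phi> \<le> 1" by (rule X.nrm_ops_le[OF _ bound]) simp
  moreover have "s = (\<lambda>n. \<phi> (x n))" using x by (auto simp: s \<phi>_def fun_eq_iff)
  ultimately show "s \<in> weak_values X x"
    unfolding weak_values_def unit_ball_def dual_def by auto
qed

lemma weak_values_isometry:
  assumes X: "seminormed_space X" and Y: "seminormed_space Y"
    and J: "isometric_isomorphism X Y J" and x: "range x \<subseteq> carrier X"
  shows "weak_values Y (\<lambda>n. J (x n)) = weak_values X x"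
proof
  have J': "linear_between X Y J" "\<And>x. x \<in> carrier X \<Longrightarrow> nrm Y (J x) = nrm X x"
    "bij_betw J (carrier X) (carrier Y)"
    using J unfolding isometric_isomorphism_def by auto
  let ?K = "inv_into (carrier X) J"
  have K: "linear_between Y X ?K" "\<And>y. y \<in> carrier Y \<Longrightarrow> nrm X (?K y) = nrm Y y"
    using isometric_isomorphism_inv[OF X J] unfolding isometric_isomorphism_def by auto
  show "weak_values Y (\<lambda>n. J (x n)) \<subseteq> weak_values X x"
    by (rule weak_values_isometry_subset[OF X Y J'(1,2) x])
  have "range (\<lambda>n. J (x n)) \<subseteq> carrier Y" using x J'(1) unfolding linear_between_def by auto
  from weak_values_isometry_subset[OF Y X K this]
  have "weak_values X (\<lambda>n. ?K (J (x n))) \<subseteq> weak_values Y (\<lambda>n. J (x n))" .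
  moreover have "?K (J (x n)) = x n" for n
    using x J'(3) by (simp add: bij_betw_def range_subsetD)
  ultimately show "weak_values X x \<subseteq> weak_values Y (\<lambda>n. J (x n))" by simp
qed

lemma ell_weak_isometry:
  assumes "seminormed_space X" "seminormed_space Y" "isometric_isomorphism X Y J"
    and x: "range x \<subseteq> carrier X"
  shows "(\<lambda>n. J (x n)) \<in> carrier (ell_weak q Y) \<longleftrightarrow> x \<in> carrier (ell_weak q X)"
    and "nrm (ell_weak q Y) (\<lambda>n. J (x n)) = nrm (ell_weak q X) x"
proof -
  have "range (\<lambda>n. J (x n)) \<subseteq> carrier Y"
    using assms(3) x unfolding isometric_isomorphism_def linear_between_def by auto
  then show "(\<lambda>n. J (x n)) \<in> carrier (ell_weak q Y) \<longleftrightarrow> x \<in> carrier (ell_weak q X)"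
    using x by (simp add: ell_weak_iff weak_values_isometry[OF assms])
  show "nrm (ell_weak q Y) (\<lambda>n. J (x n)) = nrm (ell_weak q X) x"
    by (simp add: nrm_ell_weak weak_values_isometry[OF assms])
qed

section \<open>Matching the representations of a mapping and of its linearization\<close>

context weighted_domain
begin

text \<open>The right-hand side is a bounded operator with the correct values at the evaluations,
  and these determine the linearization.\<close>

lemma linearization_tensor:
  fixes y :: "'f::cbanach"
  assumes g: "g \<in> carrier H"
  shows "(\<lambda>x. g x *\<^sub>C y) \<in> carrier (Hv U v)"
    and "linearization U v (\<lambda>x. g x *\<^sub>C y) = (\<lambda>\<phi>. linearization U v g \<phi> *\<^sub>C y)"
proof -
  interpret S: operator_space G "whole_space :: complex nvs" by (rule operator_space_G)
  interpret L: operator_space G "whole_space :: 'f nvs" by (rule operator_space_G)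
  show mem: "(\<lambda>x. g x *\<^sub>C y) \<in> carrier (Hv U v)"
    by (rule Hv_compose_linear(1)[OF g, where K = "norm y"])
      (simp_all add: scaleC_add_left scaleC_scaleC scaleC_complex_def norm_scaleC mult.commute)
  note T = linearization_properties(1)[OF g]
  show "linearization U v (\<lambda>x. g x *\<^sub>C y) = (\<lambda>\<phi>. linearization U v g \<phi> *\<^sub>C y)"
  proof (rule linearization_eqI[OF mem])
    have bound: "nrm whole_space (linearization U v g \<phi> *\<^sub>C y)
        \<le> (nrm S.ops (linearization U v g) * norm y) * nrm G \<phi>" if "\<phi> \<in> carrier G" for \<phi>
      using mult_right_mono[OF S.nrm_ops_bound[OF T that] norm_ge_zero[of y]]
      by (simp add: norm_scaleC mult_ac)
    show "(\<lambda>\<phi>. linearization U v g \<phi> *\<^sub>C y) \<in> carrier L.ops"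
      by (rule L.opsI[OF _ _ _ bound])
        (simp_all add: S.ops_add[OF T] S.ops_scaleC[OF T] S.ops_outside[OF T]
          scaleC_add_left scaleC_scaleC scaleC_complex_def)
  qed (simp add: linearization_properties(2)[OF g])
qed

text \<open>By linearity each remainder on the operator side is the linearization of the remainder
  on the mapping side, so their norms agree. The scalar linearization is an isometry onto the dual
  of \<open>G\<close> and keeps the weak condition, while \<open>y\<close> is the same on both
  sides.\<close>

lemma nuclear_rep_iff:
  fixes f :: "'e \<Rightarrow> 'f::cbanach"
  assumes f: "f \<in> carrier (Hv U v)" and g: "range g \<subseteq> carrier H"
  shows "nuclear_op_rep p G whole_space (linearization U v f) (\<lambda>n. linearization U v (g n)) y
    \<longleftrightarrow> nuclear_map_rep p U v f g y"
proof -
  interpret F: seminormed_space "Hv U v :: ('e \<Rightarrow> 'f) nvs" by (rule seminormed_space_Hv)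
  interpret S: operator_space G "whole_space :: complex nvs" by (rule operator_space_G)
  have J: "isometric_isomorphism H (dual G) (linearization U v)"
    unfolding dual_def by (rule linearization_isometric_isomorphism)
  have dual_G: "seminormed_space (dual G)" unfolding dual_def by (rule S.seminormed_space_ops)
  have lin: "linear_between (Hv U v :: ('e \<Rightarrow> 'f) nvs) (bounded_ops G whole_space) (linearization U v)"
    and iso: "\<And>h :: 'e \<Rightarrow> 'f. h \<in> carrier (Hv U v) \<Longrightarrow>
      nrm (bounded_ops G whole_space) (linearization U v h) = nrm (Hv U v) h"
    using linearization_isometric_isomorphism[where 'f = 'f] unfolding isometric_isomorphism_def by auto
  have t: "(\<lambda>x. g n x *\<^sub>C y n) \<in> carrier (Hv U v)" for n
    by (rule linearization_tensor) (use g in auto)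
  have s: "(\<Sum>n<N. (\<lambda>x. g n x *\<^sub>C y n)) \<in> carrier (Hv U v)" for N
    by (intro F.sum_mem t)
  have "nrm (bounded_ops G whole_space)
      (linearization U v f - (\<Sum>n<N. (\<lambda>\<phi>. linearization U v (g n) \<phi> *\<^sub>C y n)))
    = nrm (Hv U v) (f - (\<Sum>n<N. (\<lambda>x. g n x *\<^sub>C y n)))" for N
  proof -
    have "linearization U v (\<lambda>x. g n x *\<^sub>C y n) = (\<lambda>\<phi>. linearization U v (g n) \<phi> *\<^sub>C y n)" for n
      by (rule linearization_tensor) (use g in auto)
    then have "linearization U v f - (\<Sum>n<N. (\<lambda>\<phi>. linearization U v (g n) \<phi> *\<^sub>C y n))
      = linearization U v (f - (\<Sum>n<N. (\<lambda>x. g n x *\<^sub>C y n)))"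
      by (simp add: F.linear_between_diff[OF lin f s] F.linear_between_sum[OF lin t])
    then show ?thesis using iso[OF F.diff_mem[OF f s]] by simp
  qed
  then show ?thesis
    unfolding nuclear_op_rep_def nuclear_map_rep_def
    by (simp add: ell_weak_isometry(1)[OF H.X.seminormed_space_axioms dual_G J g])
qed

text \<open>One equality of sets settles two questions: nonemptiness is the existence of a
  representation, and the infimum is the nuclear norm. Functionals on \<open>G\<close> are lifted to
  \<open>H\<close> because the scalar linearization is onto the dual of \<open>G\<close>.\<close>

lemma nuclear_products_eq:
  fixes f :: "'e \<Rightarrow> 'f::cbanach"
  assumes f: "f \<in> carrier (Hv U v)"
  shows "{nrm (ell_weak q (dual G)) \<phi> * nrm (ell r whole_space) y
            | \<phi> y. nuclear_op_rep p G whole_space (linearization U v f) \<phi> y}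
    = {nrm (ell_weak q H) g * nrm (ell r whole_space) y | g y. nuclear_map_rep p U v f g y}"
    (is "?A = ?B")
proof -
  interpret S: operator_space G "whole_space :: complex nvs" by (rule operator_space_G)
  have J: "isometric_isomorphism H (dual G) (linearization U v)"
    unfolding dual_def by (rule linearization_isometric_isomorphism)
  have dual_G: "seminormed_space (dual G)" unfolding dual_def by (rule S.seminormed_space_ops)
  note nrm_eq = ell_weak_isometry(2)[OF H.X.seminormed_space_axioms dual_G J]
  show ?thesis
  proof
    show "?A \<subseteq> ?B"
    proof
      fix s assume "s \<in> ?A"
      then obtain \<phi> y where s: "s = nrm (ell_weak q (dual G)) \<phi> * nrm (ell r whole_space) y"
        and rep: "nuclear_op_rep p G whole_space (linearization U v f) \<phi> y" by blast
      have "range \<phi> \<subseteq> carrier (dual G)"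
        using rep unfolding nuclear_op_rep_def ell_weak_iff by blast
      then have "\<forall>n. \<exists>g\<in>carrier H. linearization U v g = \<phi> n"
        using J unfolding isometric_isomorphism_def bij_betw_def by (metis imageE range_subsetD)
      then obtain g where g: "\<And>n. g n \<in> carrier H" "\<And>n. linearization U v (g n) = \<phi> n" by metis
      then have \<phi>: "\<phi> = (\<lambda>n. linearization U v (g n))" and rg: "range g \<subseteq> carrier H" by auto
      have "nuclear_map_rep p U v f g y" using rep nuclear_rep_iff[OF f rg] by (simp add: \<phi>)
      then show "s \<in> ?B" using nrm_eq[OF rg] s \<phi> by auto
    qed
    show "?B \<subseteq> ?A"
    proof
      fix s assume "s \<in> ?B"
      then obtain g y where s: "s = nrm (ell_weak q H) g * nrm (ell r whole_space) y"
        and rep: "nuclear_map_rep p U v f g y" by blast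
      have rg: "range g \<subseteq> carrier H"
        using rep unfolding nuclear_map_rep_def ell_weak_iff by blast
      have "nuclear_op_rep p G whole_space (linearization U v f) (\<lambda>n. linearization U v (g n)) y"
        using rep nuclear_rep_iff[OF f rg] by blast
      then show "s \<in> ?A" unfolding s nrm_eq[OF rg, symmetric] by blast
    qed
  qed
qed

lemma nuclear_maps_iff:
  fixes f :: "'e \<Rightarrow> 'f::cbanach"
  assumes f: "f \<in> carrier (Hv U v)"
  shows "linearization U v f \<in> carrier (nuclear_ops p G whole_space) \<longleftrightarrow> f \<in> carrier (nuclear_maps p U v)"
    and "nrm (nuclear_ops p G whole_space) (linearization U v f) = nrm (nuclear_maps p U v) f"
proof -
  note eq = nuclear_products_eq[OF f, of "conj_index p" "ereal p" p]
  have "{s. \<exists>\<phi> y. s = nrm (ell_weak (conj_index p) (dual G)) \<phi> * nrm (ell (ereal p) whole_space) y \<and>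
        nuclear_op_rep p G whole_space (linearization U v f) \<phi> y} \<noteq> {}
      \<longleftrightarrow> {s. \<exists>g y. s = nrm (ell_weak (conj_index p) H) g * nrm (ell (ereal p) whole_space) y \<and>
        nuclear_map_rep p U v f g y} \<noteq> {}"
    using eq by simp
  then have "(\<exists>\<phi> y. nuclear_op_rep p G whole_space (linearization U v f) \<phi> y)
      \<longleftrightarrow> (\<exists>g y. nuclear_map_rep p U v f g y)"
    by simp
  then show "linearization U v f \<in> carrier (nuclear_ops p G whole_space) \<longleftrightarrow> f \<in> carrier (nuclear_maps p U v)"
    using f linearization_properties(1)[OF f] unfolding nuclear_ops_def nuclear_maps_def by simp
  show "nrm (nuclear_ops p G whole_space) (linearization U v f) = nrm (nuclear_maps p U v) f"
    unfolding nuclear_ops_def nuclear_maps_def using eq by simp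
qed

theorem linearization_nuclear_isometry:
  "isometric_isomorphism (nuclear_maps p U v :: ('e \<Rightarrow> 'f::cbanach) nvs)
     (nuclear_ops p G whole_space) (linearization U v)"
proof -
  let ?N = "nuclear_maps p U v :: ('e \<Rightarrow> 'f) nvs" and ?O = "nuclear_ops p G (whole_space :: 'f nvs)"
  have lin: "linear_between (Hv U v :: ('e \<Rightarrow> 'f) nvs) (bounded_ops G whole_space) (linearization U v)"
    and bij: "bij_betw (linearization U v) (carrier (Hv U v :: ('e \<Rightarrow> 'f) nvs))
      (carrier (bounded_ops G whole_space))"
    using linearization_isometric_isomorphism[where 'f = 'f] unfolding isometric_isomorphism_def by auto
  have N: "f \<in> carrier (Hv U v)" if "f \<in> carrier ?N" for f
    using that unfolding nuclear_maps_def by simp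
  \<comment> \<open>A nuclear operator is bounded and hence the linearization of some weighted
    holomorphic mapping, which is then nuclear itself.\<close>
  have "T \<in> linearization U v ` carrier ?N" if T: "T \<in> carrier ?O" for T
  proof -
    have "T \<in> carrier (bounded_ops G whole_space)" using T unfolding nuclear_ops_def by simp
    then obtain f where "f \<in> carrier (Hv U v)" "T = linearization U v f"
      using bij unfolding bij_betw_def by blast
    then show ?thesis using T nuclear_maps_iff(1) by blast
  qed
  then have "linearization U v ` carrier ?N = carrier ?O"
    using N nuclear_maps_iff(1) by blast
  then have "bij_betw (linearization U v) (carrier ?N) (carrier ?O)"
    using bij N unfolding bij_betw_def by (auto intro: inj_on_subset)
  moreover have "linear_between ?N ?O (linearization U v)"
    using lin N nuclear_maps_iff(1) unfolding linear_between_def by blast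
  ultimately show ?thesis
    using N nuclear_maps_iff(2) unfolding isometric_isomorphism_def by blast
qed

end

theorem proposition2p28:
  fixes U :: "'e::cbanach set" and v :: "'e \<Rightarrow> real" and p :: real
    and f :: "'e \<Rightarrow> 'f::cbanach"
  assumes "open U" and "weight_on U v" and "1 \<le> p" and "f \<in> carrier (Hv U v)"
  shows "(f \<in> carrier (nuclear_maps p U v) \<longleftrightarrow>
            linearization U v f \<in> carrier (nuclear_ops p (Gv U v) whole_space)) \<and>
         (f \<in> carrier (nuclear_maps p U v) \<longrightarrow>
            nrm (nuclear_maps p U v) f =
              nrm (nuclear_ops p (Gv U v) whole_space) (linearization U v f)) \<and>
         isometric_isomorphism
           (nuclear_maps p U v :: ('e \<Rightarrow> 'f) nvs)
           (nuclear_ops p (Gv U v) whole_space)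
           (linearization U v)"
proof -
  interpret weighted_domain U v by unfold_locales (fact assms)+
  show ?thesis
    using nuclear_maps_iff[OF assms(4)] linearization_nuclear_isometry by auto
qed

end
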